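(* Let $n\ge2$, let $q\ge 0$ be a real number, and let $\rho\in M_n(\mathbb{C})$ be a density matrix with eigenvalues $\lambda_1,\dots,\lambda_n$ (counted with multiplicity). Then the quantum Rényi entropy $\mathrm{R}_q(\rho)=R_q(\lambda_1,\dots,\lambda_n)$ is the minimum of the contextual Rényi entropy of $\rho$ over maximal contexts: $$\mathrm{R}_q(\rho)=\min\{\mathcal{R}_q(\mu_\rho)_V : V\text{ a maximal context of } M_n\}.$$
   Context: Rényi entropy: for a probability distribution $(p_1,\dots,p_k)$ and real $q\ge0$, $q\neq1$, $R_q(p_1,\dots,p_k)=\frac{1}{1-q}\ln\big[\sum_{i=1}^k p_i^q\big]$, where for $q=0$ one uses $0^0=0$ (so $R_0$ is the logarithm of the number of nonzero components); $R_1$ is the limit $q\to1$, i.e. the Shannon entropy $-\sum_i p_i\ln p_i$ (with $0\ln0=0$). $M_n=M_n(\mathbb{C})$. A density matrix is a positive semidefinite matrix of trace $1$. A context is a commutative $*$-subalgebra $V\subseteq M_n$ containing the identity $I$, with $V\neq\mathbb{C}I$. Each context is $V=\mathbb{C}P_1+\dots+\mathbb{C}P_k$ for a unique (up to order) set of nonzero pairwise orthogonal projections summing to $I$ (its canonical projections); write $V=\{P_1,\dots,P_k\}''$. A context is maximal if it is maximal under inclusion, equivalently if it has $n$ canonical projections, all of rank one. The contextual Rényi entropy of the state $\rho$ at the context $V=\{P_1,\dots,P_k\}''$ is $$\mathcal{R}_q(\mu_\rho)_V=R_q\big(\mathrm{Tr}(\rho P_1),\dots,\mathrm{Tr}(\rho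 P_k)\big).$$ *)

theory Defs
  imports
    "Jordan_Normal_Form.Schur_Decomposition"
    "Jordan_Normal_Form.VS_Connect"
    "HOL-Analysis.Analysis"
begin

text \<open>
  A finite tuple is represented by the multiset of its entries, since \<open>R\<^sub>q\<close> is symmetric in its
  arguments.  Isabelle's \<open>powr\<close> satisfies \<open>0 powr 0 = 0\<close>, which is the convention \<open>0\<^sup>0 = 0\<close> needed
  for \<open>q = 0\<close>, and \<open>ln 0 = 0\<close> gives \<open>0 ln 0 = 0\<close> for \<open>q = 1\<close>.
\<close>

definition renyi_entropy :: "real \<Rightarrow> real multiset \<Rightarrow> real" where
  "renyi_entropy q M =
     (if q = 1 then - (\<Sum>p\<in>#M. p * ln p)
      else 1 / (1 - q) * ln (\<Sum>p\<in>#M. p powr q))"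

definition mat_trace :: "complex mat \<Rightarrow> complex" where
  "mat_trace A = (\<Sum>i<dim_row A. A $$ (i, i))"

text \<open>
  The order on \<^typ>\<open>complex\<close> is the one under which \<open>0 \<le> z\<close> means that \<open>z\<close> is real and nonnegative.
\<close>

definition positive_semidefinite :: "nat \<Rightarrow> complex mat \<Rightarrow> bool" where
  "positive_semidefinite n A \<longleftrightarrow>
     A \<in> carrier_mat n n \<and> mat_adjoint A = A \<and>
     (\<forall>v \<in> carrier_vec n. 0 \<le> (A *\<^sub>v v) \<bullet>c v)"

definition density_matrix :: "nat \<Rightarrow> complex mat \<Rightarrow> bool" where
  "density_matrix n \<rho> \<longleftrightarrow> positive_semidefinite n \<rho> \<and> mat_trace \<rho> = 1"

text \<open>
  The multiset \<open>proots (char_poly \<rho>)\<close> lists the eigenvalues with multiplicity; for a density matrix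
  they are real, and \<^const>\<open>Re\<close> is only the conversion to type \<^typ>\<open>real\<close>.
\<close>

definition quantum_renyi_entropy :: "real \<Rightarrow> complex mat \<Rightarrow> real" where
  "quantum_renyi_entropy q \<rho> = renyi_entropy q (image_mset Re (proots (char_poly \<rho>)))"

lemma quantum_renyi_entropy_eigenvalues:
  fixes ev :: "nat \<Rightarrow> real"
  assumes "char_poly \<rho> = (\<Prod>i<n. [:- complex_of_real (ev i), 1:])"
  shows "quantum_renyi_entropy q \<rho> = renyi_entropy q (image_mset ev (mset_set {..<n}))"
proof -
  have "proots (\<Prod>i<k. [:- complex_of_real (ev i), 1:]) =
          image_mset (\<lambda>i. complex_of_real (ev i)) (mset_set {..<k})" for k
  proof (induction k)
    case (Suc k)
    have nz: "(\<Prod>i<k. [:- complex_of_real (ev i), 1:]) \<noteq> 0" by simp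
    have "proots ((\<Prod>i<k. [:- complex_of_real (ev i), 1:]) * [:- complex_of_real (ev k), 1:]) =
            proots (\<Prod>i<k. [:- complex_of_real (ev i), 1:]) + {#complex_of_real (ev k)#}"
      using proots_mult[OF nz, of "[:- complex_of_real (ev k), 1:]"]
      by (simp only: proots_linear_factor minus_minus) simp
    then show ?case
      by (simp only: prod.lessThan_Suc Suc) (simp add: lessThan_Suc)
  qed simp
  then show ?thesis
    using assms by (simp add: quantum_renyi_entropy_def multiset.map_comp o_def)
qed

definition commutative_star_subalgebra :: "nat \<Rightarrow> complex mat set \<Rightarrow> bool" where
  "commutative_star_subalgebra n V \<longleftrightarrow>
     V \<subseteq> carrier_mat n n \<and> V \<noteq> {} \<and>
     (\<forall>A\<in>V. \<forall>B\<in>V. A + B \<in> V) \<and>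
     (\<forall>c. \<forall>A\<in>V. c \<cdot>\<^sub>m A \<in> V) \<and>
     (\<forall>A\<in>V. \<forall>B\<in>V. A * B \<in> V) \<and>
     (\<forall>A\<in>V. mat_adjoint A \<in> V) \<and>
     (\<forall>A\<in>V. \<forall>B\<in>V. A * B = B * A)"

definition quantum_context :: "nat \<Rightarrow> complex mat set \<Rightarrow> bool" where
  "quantum_context n V \<longleftrightarrow>
     commutative_star_subalgebra n V \<and> 1\<^sub>m n \<in> V \<and> V \<noteq> range (\<lambda>c. c \<cdot>\<^sub>m 1\<^sub>m n)"

definition maximal_context :: "nat \<Rightarrow> complex mat set \<Rightarrow> bool" where
  "maximal_context n V \<longleftrightarrow>
     quantum_context n V \<and> (\<forall>W. quantum_context n W \<and> V \<subseteq> W \<longrightarrow> W = V)"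

definition projection :: "nat \<Rightarrow> complex mat \<Rightarrow> bool" where
  "projection n P \<longleftrightarrow> P \<in> carrier_mat n n \<and> mat_adjoint P = P \<and> P * P = P"

definition is_canonical_projections :: "nat \<Rightarrow> complex mat set \<Rightarrow> complex mat set \<Rightarrow> bool" where
  "is_canonical_projections n V S \<longleftrightarrow>
     finite S \<and>
     (\<forall>P\<in>S. projection n P \<and> P \<noteq> 0\<^sub>m n n) \<and>
     (\<forall>P\<in>S. \<forall>Q\<in>S. P \<noteq> Q \<longrightarrow> P * Q = 0\<^sub>m n n) \<and>
     finsum (module_mat TYPE(complex) n n) (\<lambda>P. P) S = 1\<^sub>m n \<and>
     V = LinearCombinations.module.span class_ring (module_mat TYPE(complex) n n) S"

definition canonical_projections :: "nat \<Rightarrow> complex mat set \<Rightarrow> complex mat set" where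
  "canonical_projections n V = (THE S. is_canonical_projections n V S)"

text \<open>
  For a density matrix \<open>\<rho>\<close> and a projection \<open>P\<close> the trace of \<open>\<rho> P\<close> is real, so \<^const>\<open>Re\<close> is again
  only a type conversion.
\<close>

definition contextual_renyi_entropy :: "real \<Rightarrow> nat \<Rightarrow> complex mat \<Rightarrow> complex mat set \<Rightarrow> real" where
  "contextual_renyi_entropy q n \<rho> V =
     renyi_entropy q
       (image_mset (\<lambda>P. Re (mat_trace (\<rho> * P))) (mset_set (canonical_projections n V)))"

end

theory Submission
  imports Defs
begin

text \<open>
  A maximal context is the algebra of all matrices diagonal in some orthonormal basis, because a
  commuting family closed under adjoints has an orthonormal basis of common eigenvectors.  If \<open>U\<close>
  is the unitary matrix of that basis, the outcome probabilities of \<open>\<rho>\<close> are the diagonal entries of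
  \<open>U\<^sup>* \<rho> U\<close>.  Writing \<open>\<rho> = W D W\<^sup>*\<close> with \<open>D\<close> the diagonal matrix of eigenvalues and \<open>Z = U\<^sup>* W\<close>, they are
  the image of the eigenvalues under the doubly stochastic matrix \<open>|Z j i|\<^sup>2\<close>, so Jensen's inequality
  shows that their entropy is at least that of the eigenvalues, with equality for \<open>U = W\<close>.
\<close>

section \<open>Entropy under doubly stochastic maps\<close>

text \<open>One inequality serves every \<open>q\<close>, applied to \<open>t powr q\<close> for
  \<open>q < 1\<close>, to \<open>- (t * ln t)\<close> for \<open>q = 1\<close> and to
  \<open>- (t powr q)\<close> for \<open>q > 1\<close>; in the last case the negative factor
  \<open>1 / (1 - q)\<close> turns the sign back. A context is an infinite family of matrices, so
  its members cannot simply be diagonalized one after another; common eigenvectors come instead from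
  a minimal invariant subspace. Two facts tie orthonormal bases to the definitions. For
  \<open>n \<ge> 2\<close> the matrices diagonal in a fixed basis form a context, so a maximal
  context inside this algebra equals it; conversely the algebra is maximal because it contains a
  matrix with distinct eigenvalues. Moreover \<open>canonical_projections\<close> is a definite
  description, whose value can be computed only after uniqueness is known: canonical projections are
  the atoms of the algebra that they span, so two such systems for one algebra coincide.\<close>

text \<open>
  Supporting lines are required only at \<open>p > 0\<close>: for \<open>q \<le> 1\<close> the functions in question have none at
  \<open>0\<close>, and \<open>t powr 0\<close> is not even continuous there.
\<close>

lemma jensen_supporting:
  fixes f :: "real \<Rightarrow> real" and w x :: "'i \<Rightarrow> real"
  assumes fin: "finite I"
    and w: "\<And>i. i \<in> I \<Longrightarrow> 0 \<le> w i" and x: "\<And>i. i \<in> I \<Longrightarrow> 0 \<le> x i"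
    and sum_w: "sum w I = 1" and f0: "f 0 = 0"
    and supp: "\<And>p. 0 < p \<Longrightarrow> \<exists>m. \<forall>y\<ge>0. f y \<le> f p + m * (y - p)"
  shows "(\<Sum>i\<in>I. w i * f (x i)) \<le> f (\<Sum>i\<in>I. w i * x i)"
proof (cases "(\<Sum>i\<in>I. w i * x i) = 0")
  case True
  \<comment> \<open>At mean zero no supporting line is available, but each index has weight zero or
    value zero, so \<open>f 0 = 0\<close> makes both sides vanish.\<close>
  then have "\<forall>i\<in>I. w i * x i = 0"
    using sum_nonneg_eq_0_iff[OF fin, of "\<lambda>i. w i * x i"] w x by simp
  then have "(\<Sum>i\<in>I. w i * f (x i)) = 0"
    using f0 by (intro sum.neutral) auto
  with True f0 show ?thesis by simp
next
  case False
  define p where "p = (\<Sum>i\<in>I. w i * x i)"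
  have "0 < p"
    using False sum_nonneg[of I "\<lambda>i. w i * x i"] w x by (simp add: p_def less_le)
  from supp[OF this] obtain m where m: "\<And>y. 0 \<le> y \<Longrightarrow> f y \<le> f p + m * (y - p)" by blast
  have "(\<Sum>i\<in>I. w i * f (x i)) \<le> (\<Sum>i\<in>I. w i * (f p + m * (x i - p)))"
    using m w x by (intro sum_mono mult_left_mono) auto
  also have "\<dots> = (\<Sum>i\<in>I. f p * w i + m * (w i * x i) - m * p * w i)"
    by (simp add: algebra_simps)
  also have "\<dots> = f p * sum w I + m * p - m * p * sum w I"
    by (simp only: sum_subtractf sum.distrib sum_distrib_left[symmetric] p_def)
  also have "\<dots> = f p" using sum_w by simp
  finally show ?thesis by (simp add: p_def)
qed

text \<open>The column sums split each \<open>f (x i)\<close> into shares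
  \<open>w j i * f (x i)\<close>; regrouped by \<open>j\<close>, the row sums make every group a
  convex combination, to which Jensen's inequality applies.\<close>

lemma sum_doubly_stochastic_le:
  fixes f :: "real \<Rightarrow> real" and w :: "'i \<Rightarrow> 'i \<Rightarrow> real" and x :: "'i \<Rightarrow> real"
  assumes fin: "finite I"
    and w: "\<And>i j. i \<in> I \<Longrightarrow> j \<in> I \<Longrightarrow> 0 \<le> w j i" and x: "\<And>i. i \<in> I \<Longrightarrow> 0 \<le> x i"
    and rows: "\<And>j. j \<in> I \<Longrightarrow> (\<Sum>i\<in>I. w j i) = 1"
    and cols: "\<And>i. i \<in> I \<Longrightarrow> (\<Sum>j\<in>I. w j i) = 1"
    and f0: "f 0 = 0"
    and supp: "\<And>p. 0 < p \<Longrightarrow> \<exists>m. \<forall>y\<ge>0. f y \<le> f p + m * (y - p)"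
  shows "(\<Sum>i\<in>I. f (x i)) \<le> (\<Sum>j\<in>I. f (\<Sum>i\<in>I. w j i * x i))"
proof -
  have "(\<Sum>i\<in>I. f (x i)) = (\<Sum>i\<in>I. (\<Sum>j\<in>I. w j i) * f (x i))"
    using cols by simp
  also have "\<dots> = (\<Sum>j\<in>I. \<Sum>i\<in>I. w j i * f (x i))"
    unfolding sum_distrib_right by (rule sum.swap)
  also have "\<dots> \<le> (\<Sum>j\<in>I. f (\<Sum>i\<in>I. w j i * x i))"
    using fin w x rows f0 supp by (intro sum_mono jensen_supporting) auto
  finally show ?thesis .
qed

section \<open>Supporting lines of power functions and of the Shannon function\<close>

lemma powr_le_tangent:
  fixes q t :: real
  assumes "0 \<le> q" "q \<le> 1" "0 \<le> t"
  shows "t powr q \<le> 1 + q * (t - 1)"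
proof (cases "t = 0")
  case False
  \<comment> \<open>Weighted AM-GM for \<open>t\<close> and \<open>1\<close> with weights
    \<open>q\<close> and \<open>1 - q\<close>; it asks for positive arguments, which is why
    \<open>t = 0\<close> is split off.\<close>
  then show ?thesis
    using Youngs_inequality_0[of q "1 - q" t 1] assms by (simp add: algebra_simps)
qed (use assms in simp)

text \<open>The concave case for the exponent \<open>1 / q\<close>, read backwards: applied to the
  value \<open>s\<close> of the tangent it gives \<open>s powr (1/q) \<le> t\<close>, and the power
  \<open>q\<close> of this is the claim. Where the tangent is not positive, nonnegativity of
  \<open>powr\<close> suffices.\<close>

lemma powr_ge_tangent:
  fixes q t :: real
  assumes "1 < q" "0 \<le> t"
  shows "1 + q * (t - 1) \<le> t powr q"
proof (cases "1 + q * (t - 1) \<le> 0")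
  case False
  define s where "s = 1 + q * (t - 1)"
  have "s powr (1/q) \<le> 1 + (1/q) * (s - 1)"
    using assms False by (intro powr_le_tangent) (auto simp: s_def)
  also have "\<dots> = t" using assms by (simp add: s_def)
  finally have "(s powr (1/q)) powr q \<le> t powr q"
    using assms by (intro powr_mono2) auto
  then show ?thesis using assms False by (simp add: powr_powr s_def)
qed (use order_trans in fastforce)

lemma powr_scale:
  fixes y p q :: real
  assumes "0 < p" "0 \<le> y"
  shows "y powr q = p powr q * (y / p) powr q"
  using assms by (simp add: powr_mult[symmetric])

text \<open>Homogeneity reduces this to the tangent at \<open>1\<close>, evaluated at
  \<open>y / p\<close>; the slope \<open>p powr q * q / p\<close> is the derivative at
  \<open>p\<close>. For \<open>q = 0\<close> the line is the constant \<open>1\<close>, lying above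
  the indicator of nonzero arguments.\<close>

lemma powr_concave_supporting:
  fixes p q :: real
  assumes "0 \<le> q" "q \<le> 1" "0 < p"
  shows "\<exists>m. \<forall>y\<ge>0. y powr q \<le> p powr q + m * (y - p)"
proof (intro exI allI impI)
  fix y :: real assume y: "0 \<le> y"
  have "y powr q \<le> p powr q * (1 + q * (y / p - 1))"
    unfolding powr_scale[OF assms(3) y] using assms y by (intro mult_left_mono powr_le_tangent) auto
  also have "\<dots> = p powr q + (p powr q * q / p) * (y - p)"
    using assms by (simp add: field_simps)
  finally show "y powr q \<le> p powr q + (p powr q * q / p) * (y - p)" .
qed

lemma powr_convex_supporting:
  fixes p q :: real
  assumes "1 < q" "0 < p"
  shows "\<exists>m. \<forall>y\<ge>0. - (y powr q) \<le> - (p powr q) + m * (y - p)"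
proof (intro exI allI impI)
  fix y :: real assume y: "0 \<le> y"
  have "p powr q * (1 + q * (y / p - 1)) \<le> y powr q"
    unfolding powr_scale[OF assms(2) y] using assms y by (intro mult_left_mono powr_ge_tangent) auto
  also have "p powr q * (1 + q * (y / p - 1)) = p powr q + (p powr q * q / p) * (y - p)"
    using assms by (simp add: field_simps)
  finally show "- (y powr q) \<le> - (p powr q) + (- (p powr q * q / p)) * (y - p)" by simp
qed

text \<open>This is \<open>ln z \<le> z - 1\<close> at \<open>z = p / y\<close>, multiplied by
  \<open>y\<close>; the slope \<open>- ln p - 1\<close> is the derivative of
  \<open>- (t * ln t)\<close> at \<open>p\<close>.\<close>

lemma shannon_supporting:
  fixes p :: real
  assumes "0 < p"
  shows "\<exists>m. \<forall>y\<ge>0. - (y * ln y) \<le> - (p * ln p) + m * (y - p)"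
proof (intro exI allI impI)
  fix y :: real assume y: "0 \<le> y"
  have "y * ln (p / y) \<le> p - y"
  proof (cases "y = 0")
    case False
    then have "y * ln (p / y) \<le> y * (p / y - 1)"
      using y assms by (intro mult_left_mono ln_le_minus_one) auto
    also have "\<dots> = p - y" using False by (simp add: field_simps)
    finally show ?thesis .
  qed (use assms in simp)
  moreover have "y * ln (p / y) = y * ln p - y * ln y"
    using y assms by (cases "y = 0") (auto simp: ln_div algebra_simps)
  ultimately show "- (y * ln y) \<le> - (p * ln p) + (- ln p - 1) * (y - p)"
    by (simp add: algebra_simps)
qed

text \<open>Permits passing from power sums to their logarithms. It holds for every real
  \<open>q\<close>, because \<open>powr\<close> is positive at any nonzero base and some
  \<open>x i\<close> is nonzero.\<close>

lemma sum_powr_pos: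
  fixes x :: "'i \<Rightarrow> real"
  assumes "finite I" "\<And>i. i \<in> I \<Longrightarrow> 0 \<le> x i" "sum x I = 1"
  shows "0 < (\<Sum>i\<in>I. x i powr q)"
proof -
  obtain i where "i \<in> I" "x i \<noteq> 0"
    using assms(3) by (metis sum.neutral zero_neq_one)
  then show ?thesis
    using assms(1) by (intro sum_pos2[of I i]) auto
qed

lemma renyi_entropy_doubly_stochastic_mono:
  fixes w :: "'i \<Rightarrow> 'i \<Rightarrow> real" and x :: "'i \<Rightarrow> real"
  assumes q: "0 \<le> q" and fin: "finite I"
    and w: "\<And>i j. i \<in> I \<Longrightarrow> j \<in> I \<Longrightarrow> 0 \<le> w j i" and x: "\<And>i. i \<in> I \<Longrightarrow> 0 \<le> x i"
    and rows: "\<And>j. j \<in> I \<Longrightarrow> (\<Sum>i\<in>I. w j i) = 1"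
    and cols: "\<And>i. i \<in> I \<Longrightarrow> (\<Sum>j\<in>I. w j i) = 1"
    and sum_x: "sum x I = 1"
  shows "renyi_entropy q (image_mset x (mset_set I))
    \<le> renyi_entropy q (image_mset (\<lambda>j. \<Sum>i\<in>I. w j i * x i) (mset_set I))"
proof -
  define y where "y j = (\<Sum>i\<in>I. w j i * x i)" for j
  have y: "0 \<le> y j" if "j \<in> I" for j
    using that w x by (auto simp: y_def intro!: sum_nonneg)
  have sum_y: "sum y I = 1"
  proof -
    have "sum y I = (\<Sum>i\<in>I. (\<Sum>j\<in>I. w j i) * x i)"
      unfolding y_def sum_distrib_right by (rule sum.swap)
    then show ?thesis using cols sum_x by simp
  qed
  have mono: "(\<Sum>i\<in>I. f (x i)) \<le> (\<Sum>j\<in>I. f (y j))"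
    if "f 0 = 0" "\<And>p. 0 < p \<Longrightarrow> \<exists>m. \<forall>t\<ge>0. f t \<le> f p + m * (t - p)" for f :: "real \<Rightarrow> real"
    unfolding y_def using fin w x rows cols that by (intro sum_doubly_stochastic_le)
  have pos: "0 < (\<Sum>i\<in>I. x i powr q)" "0 < (\<Sum>i\<in>I. y i powr q)"
    using sum_powr_pos fin x y sum_x sum_y by auto
  have sum_mset: "(\<Sum>p\<in>#image_mset z (mset_set I). g p) = (\<Sum>i\<in>I. g (z i))"
    for g :: "real \<Rightarrow> real" and z :: "'i \<Rightarrow> real"
    by (simp add: multiset.map_comp o_def sum_unfold_sum_mset)
  consider "q < 1" | "q = 1" | "1 < q" by linarith
  then have "renyi_entropy q (image_mset x (mset_set I)) \<le> renyi_entropy q (image_mset y (mset_set I))"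
  proof cases
    case 1
    have "(\<Sum>i\<in>I. x i powr q) \<le> (\<Sum>j\<in>I. y j powr q)"
      using mono[of "\<lambda>t. t powr q"] powr_concave_supporting q 1 by auto
    then show ?thesis
      using 1 pos by (auto simp: renyi_entropy_def sum_mset intro!: divide_right_mono)
  next
    case 2
    have "(\<Sum>i\<in>I. - (x i * ln (x i))) \<le> (\<Sum>j\<in>I. - (y j * ln (y j)))"
      using mono[of "\<lambda>t. - (t * ln t)"] shannon_supporting by auto
    then show ?thesis
      using 2 by (simp add: renyi_entropy_def sum_mset sum_negf)
  next
    case 3
    \<comment> \<open>Here \<open>t powr q\<close> is convex, so its negative enters
      \<open>mono\<close> and the power sums decrease; the negative factor
      \<open>1 / (1 - q)\<close> reverses the logarithms once more.\<close>
    have "(\<Sum>i\<in>I. - (x i powr q)) \<le> (\<Sum>j\<in>I. - (y j powr q))"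
      using mono[of "\<lambda>t. - (t powr q)"] powr_convex_supporting 3 by auto
    then have "ln (\<Sum>j\<in>I. y j powr q) \<le> ln (\<Sum>i\<in>I. x i powr q)"
      using pos by (simp add: sum_negf)
    then show ?thesis
      using 3 by (simp add: renyi_entropy_def sum_mset divide_right_mono_neg)
  qed
  then show ?thesis by (simp add: y_def[abs_def])
qed

section \<open>Simultaneous unitary diagonalization\<close>

lemma index_mat_adjoint:
  "i < dim_col A \<Longrightarrow> j < dim_row A \<Longrightarrow> mat_adjoint A $$ (i, j) = conjugate (A $$ (j, i))"
  by (simp add: mat_adjoint_def mat_of_rows_def)

lemma dim_mat_adjoint [simp]:
  "dim_row (mat_adjoint A) = dim_col A" "dim_col (mat_adjoint A) = dim_row A"
  by (simp_all add: mat_adjoint_def)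

lemma mat_adjoint_carrier [simp, intro]:
  "A \<in> carrier_mat m n \<Longrightarrow> mat_adjoint A \<in> carrier_mat n m"
  by (intro carrier_matI) auto

lemma mat_adjoint_adjoint [simp]: "mat_adjoint (mat_adjoint A) = A"
  by (rule eq_matI) (simp_all add: index_mat_adjoint)

lemma mat_adjoint_mult:
  fixes A B :: "complex mat"
  assumes "A \<in> carrier_mat m n" "B \<in> carrier_mat n k"
  shows "mat_adjoint (A * B) = mat_adjoint B * mat_adjoint A"
proof (rule eq_matI)
  fix i j
  assume "i < dim_row (mat_adjoint B * mat_adjoint A)" "j < dim_col (mat_adjoint B * mat_adjoint A)"
  then have ij: "i < k" "j < m" using assms by auto
  have "mat_adjoint (A * B) $$ (i, j) = (\<Sum>l\<in>{0..<n}. cnj (A $$ (j,l)) * cnj (B $$ (l,i)))"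
    using assms ij by (simp add: index_mat_adjoint scalar_prod_def)
  also have "\<dots> = (\<Sum>l\<in>{0..<n}. cnj (B $$ (l,i)) * cnj (A $$ (j,l)))"
    by (intro sum.cong refl mult.commute)
  also have "\<dots> = (mat_adjoint B * mat_adjoint A) $$ (i, j)"
    using assms ij by (simp add: index_mat_adjoint scalar_prod_def)
  finally show "mat_adjoint (A * B) $$ (i, j) = (mat_adjoint B * mat_adjoint A) $$ (i, j)" .
qed (use assms in auto)

lemma inner_mult_mat_vec:
  fixes A :: "complex mat"
  assumes A: "A \<in> carrier_mat n n" and v: "v \<in> carrier_vec n" and w: "w \<in> carrier_vec n"
  shows "(A *\<^sub>v v) \<bullet>c w = v \<bullet>c (mat_adjoint A *\<^sub>v w)"
proof -
  have "(A *\<^sub>v v) \<bullet>c w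
      = (\<Sum>i\<in>{0..<n}. \<Sum>j\<in>{0..<n}. A $$ (i,j) * vec_index v j * cnj (vec_index w i))"
    using A v w by (auto simp: scalar_prod_def sum_distrib_right intro!: sum.cong)
  also have "\<dots> = (\<Sum>j\<in>{0..<n}. \<Sum>i\<in>{0..<n}. A $$ (i,j) * vec_index v j * cnj (vec_index w i))"
    by (rule sum.swap)
  also have "\<dots> = v \<bullet>c (mat_adjoint A *\<^sub>v w)"
    using A v w by (auto simp: scalar_prod_def sum_distrib_left index_mat_adjoint intro!: sum.cong)
  finally show ?thesis .
qed

section \<open>Subspaces, heights and common eigenvectors\<close>

definition lin_subspace :: "nat \<Rightarrow> complex Matrix.vec set \<Rightarrow> bool" where
  "lin_subspace n X \<longleftrightarrow> X \<subseteq> carrier_vec n \<and> 0\<^sub>v n \<in> X \<and>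
     (\<forall>v\<in>X. \<forall>w\<in>X. v + w \<in> X) \<and> (\<forall>c. \<forall>v\<in>X. c \<cdot>\<^sub>v v \<in> X)"

lemma lin_subspace_lincomb:
  assumes "lin_subspace n X" "v \<in> X" "w \<in> X"
  shows "v + c \<cdot>\<^sub>v w \<in> X"
  using assms by (auto simp: lin_subspace_def)

text \<open>
  Heights (one plus the index of the last nonzero entry) serve twice: an upper triangular matrix minus
  its \<open>k\<close>-th diagonal entry lowers height \<open>k + 1\<close>, which produces eigenvectors inside invariant
  subspaces, and the heights occurring in a subspace replace its dimension in minimality arguments.
\<close>

definition height :: "complex Matrix.vec \<Rightarrow> nat" where
  "height v = (LEAST k. \<forall>j<dim_vec v. k \<le> j \<longrightarrow> vec_index v j = 0)"

lemma height_le_iff: "height v \<le> k \<longleftrightarrow> (\<forall>j<dim_vec v. k \<le> j \<longrightarrow> vec_index v j = 0)"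
proof
  have "\<forall>j<dim_vec v. height v \<le> j \<longrightarrow> vec_index v j = 0"
    unfolding height_def by (rule LeastI[of _ "dim_vec v"]) simp
  then show "height v \<le> k \<Longrightarrow> \<forall>j<dim_vec v. k \<le> j \<longrightarrow> vec_index v j = 0" by auto
qed (simp add: height_def Least_le)

lemma height_le_dim: "height v \<le> dim_vec v"
  by (simp add: height_le_iff)

lemma height_pos:
  assumes "v \<in> carrier_vec n" "v \<noteq> 0\<^sub>v n"
  shows "0 < height v"
proof (rule ccontr)
  assume "\<not> 0 < height v"
  then have "height v \<le> 0" by simp
  then have "v = 0\<^sub>v n"
    using assms(1) unfolding height_le_iff by (intro eq_vecI) auto
  with assms(2) show False by simp
qed

lemma height_Suc_nonzero:
  assumes "height v = Suc k"
  shows "vec_index v k \<noteq> 0"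
proof
  assume 0: "vec_index v k = 0"
  have "height v \<le> k"
    unfolding height_le_iff
  proof (intro allI impI)
    fix j assume "j < dim_vec v" "k \<le> j"
    then show "vec_index v j = 0"
      using 0 height_le_iff[of v "Suc k"] assms by (cases "j = k") auto
  qed
  with assms show False by simp
qed

text \<open>No matrix of the restriction of \<open>B\<close> to \<open>X\<close> is formed. In the
  coordinates \<open>Q *\<^sub>v v\<close>, where \<open>B\<close> becomes the triangular
  \<open>T\<close>, a nonzero \<open>v\<close> in \<open>X\<close> of least height is taken;
  \<open>B\<close> minus the matching diagonal entry of \<open>T\<close> keeps it in
  \<open>X\<close> and lowers its height, so minimality forces the result to be zero.\<close>

lemma invariant_subspace_eigenvector:
  fixes B :: "complex mat"
  assumes B: "B \<in> carrier_mat n n" and X: "lin_subspace n X"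
    and inv: "\<And>v. v \<in> X \<Longrightarrow> B *\<^sub>v v \<in> X"
    and nz: "\<exists>v\<in>X. v \<noteq> 0\<^sub>v n"
  obtains v c where "v \<in> X" "v \<noteq> 0\<^sub>v n" "B *\<^sub>v v = c \<cdot>\<^sub>v v"
proof -
  obtain es where "char_poly B = (\<Prod>a\<leftarrow>es. [:- a, 1:])"
    using char_poly_factorized[OF B] by blast
  then obtain T where T: "T \<in> carrier_mat n n" "upper_triangular T" and "similar_mat B T"
    using schur_decomposition_exists[OF B] by blast
  then obtain P Q where "similar_mat_wit B T P Q" by (auto simp: similar_mat_def)
  then have P: "P \<in> carrier_mat n n" and Q: "Q \<in> carrier_mat n n"
    and PQ: "P * Q = 1\<^sub>m n" and QP: "Q * P = 1\<^sub>m n" and BPTQ: "B = P * T * Q"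
    using B by (auto simp: similar_mat_wit_def Let_def)
  have Xc: "v \<in> carrier_vec n" if "v \<in> X" for v
    using X that by (auto simp: lin_subspace_def)
  have QB: "Q *\<^sub>v (B *\<^sub>v v) = T *\<^sub>v (Q *\<^sub>v v)" if v: "v \<in> carrier_vec n" for v
  proof -
    note assoc = assoc_mult_mat[of _ n n _ n _ n] mult_carrier_mat[of _ n n _ n]
    have "Q * B = Q * P * (T * Q)"
      using P Q T(1) unfolding BPTQ by (simp only: assoc)
    also have "\<dots> = T * Q" using QP Q T(1) by simp
    finally have QB: "Q * B = T * Q" .
    have "Q *\<^sub>v (B *\<^sub>v v) = (Q * B) *\<^sub>v v" using Q B v by (rule assoc_mult_mat_vec[symmetric])
    also have "\<dots> = T *\<^sub>v (Q *\<^sub>v v)"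
      unfolding QB using T(1) Q v by (rule assoc_mult_mat_vec)
    finally show ?thesis .
  qed
  \<comment> \<open>Injectivity of \<open>Q\<close> makes the height of \<open>Q *\<^sub>v v\<close>
    positive for nonzero \<open>v\<close>, so that it can be written as
    \<open>Suc k\<close>.\<close>
  have Qinj: "v = 0\<^sub>v n" if v: "v \<in> carrier_vec n" and "Q *\<^sub>v v = 0\<^sub>v n" for v
  proof -
    have "v = (P * Q) *\<^sub>v v" using PQ v by simp
    also have "\<dots> = P *\<^sub>v (Q *\<^sub>v v)" using P Q v by (rule assoc_mult_mat_vec)
    also have "\<dots> = 0\<^sub>v n" unfolding that(2) using P by (intro eq_vecI) auto
    finally show ?thesis .
  qed
  from nz obtain v' where "v' \<in> X \<and> v' \<noteq> 0\<^sub>v n" by blast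
  from ex_has_least_nat[of "\<lambda>v. v \<in> X \<and> v \<noteq> 0\<^sub>v n", OF this, of "\<lambda>v. height (Q *\<^sub>v v)"]
  obtain v where v: "v \<in> X" "v \<noteq> 0\<^sub>v n"
    and least: "\<And>w. w \<in> X \<Longrightarrow> w \<noteq> 0\<^sub>v n \<Longrightarrow> height (Q *\<^sub>v v) \<le> height (Q *\<^sub>v w)"
    by blast
  define x where "x = Q *\<^sub>v v"
  have x: "x \<in> carrier_vec n" using mult_mat_vec_carrier[OF Q Xc[OF v(1)]] by (simp add: x_def)
  have "x \<noteq> 0\<^sub>v n" using Qinj[OF Xc[OF v(1)]] v(2) by (auto simp: x_def)
  then obtain k where k: "height x = Suc k"
    using height_pos[OF x] gr0_implies_Suc by blast
  have kn: "k < n" using height_le_dim[of x] k x by auto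
  have x0: "vec_index x j = 0" if "j < n" "Suc k \<le> j" for j
    using height_le_iff[of x "Suc k"] that x k by auto
  define w where "w = B *\<^sub>v v + (- (T $$ (k,k))) \<cdot>\<^sub>v v"
  have wX: "w \<in> X" using lin_subspace_lincomb[OF X inv v(1)] v(1) by (simp add: w_def)
  have Qw: "Q *\<^sub>v w = T *\<^sub>v x + (- (T $$ (k,k))) \<cdot>\<^sub>v x"
    unfolding w_def x_def QB[OF Xc[OF v(1)], symmetric]
      mult_mat_vec[OF Q Xc[OF v(1)], symmetric]
    using Q Xc[OF inv[OF v(1)]] smult_carrier_vec[THEN iffD2, OF Xc[OF v(1)]]
    by (rule mult_add_distrib_mat_vec)
  have "height (Q *\<^sub>v w) \<le> k"
    unfolding height_le_iff
  proof (intro allI impI)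
    fix j assume "j < dim_vec (Q *\<^sub>v w)" and kj: "k \<le> j"
    then have j: "j < n" using Q by simp
    have "vec_index (T *\<^sub>v x) j = (\<Sum>i\<in>{0..<n}. T $$ (j,i) * vec_index x i)"
      using T x j by (simp add: scalar_prod_def)
    \<comment> \<open>Terms with \<open>i > k\<close> vanish by the height of \<open>x\<close>,
      terms with \<open>i < k \<le> j\<close> by triangularity of \<open>T\<close>.\<close>
    also have "\<dots> = (\<Sum>i\<in>{0..<n}. if i = k then T $$ (j,k) * vec_index x k else 0)"
    proof (intro sum.cong refl)
      fix i assume i: "i \<in> {0..<n}"
      show "T $$ (j,i) * vec_index x i = (if i = k then T $$ (j,k) * vec_index x k else 0)"
        using x0[of i] i T j kj upper_triangularD[of T i j] by (cases i k rule: linorder_cases) auto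
    qed
    also have "\<dots> = T $$ (j,k) * vec_index x k" using kn by simp
    finally have Tx: "vec_index (T *\<^sub>v x) j = T $$ (j,k) * vec_index x k" .
    \<comment> \<open>In row \<open>k\<close> the subtracted diagonal entry cancels the one
      remaining term; in later rows both \<open>T $$ (j,k)\<close> and the entry of \<open>x\<close>
      are zero.\<close>
    show "vec_index (Q *\<^sub>v w) j = 0"
    proof (cases "j = k")
      case True
      then show ?thesis using Tx j x T unfolding Qw by simp
    next
      case False
      then show ?thesis
        using Tx j x T x0[of j] kj upper_triangularD[of T k j] unfolding Qw by simp
    qed
  qed
  then have "w = 0\<^sub>v n"
    using least[OF wX] k unfolding x_def by fastforce
  then have "B *\<^sub>v v = T $$ (k,k) \<cdot>\<^sub>v v"
  proof -
    have "vec_index (B *\<^sub>v v) i = vec_index (T $$ (k,k) \<cdot>\<^sub>v v) i" if "i < n" for i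
    proof -
      have "vec_index w i = 0" using \<open>w = 0\<^sub>v n\<close> that by simp
      then show ?thesis using B Xc[OF v(1)] that by (simp add: w_def)
    qed
    then show ?thesis using B Xc[OF v(1)] by (intro eq_vecI) auto
  qed
  with v that show ?thesis by blast
qed

definition pivots :: "complex Matrix.vec set \<Rightarrow> nat set" where
  "pivots X = {k. \<exists>v\<in>X. height v = Suc k}"

lemma pivots_subset:
  assumes "lin_subspace n X"
  shows "pivots X \<subseteq> {..<n}"
proof
  fix k assume "k \<in> pivots X"
  then obtain v where "v \<in> X" "height v = Suc k" by (auto simp: pivots_def)
  then show "k \<in> {..<n}"
    using height_le_dim[of v] assms by (auto simp: lin_subspace_def)
qed

text \<open>The new pivot comes from an element \<open>x\<close> of \<open>X\<close> outside
  \<open>Y\<close> of least height. If \<open>Y\<close> had an element \<open>y\<close> of the same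
  height, a multiple of \<open>y\<close> could be subtracted to cancel the last nonzero entry of
  \<open>x\<close>, leaving an element of \<open>X\<close> outside \<open>Y\<close> of smaller
  height.\<close>

lemma pivots_strict_mono:
  assumes X: "lin_subspace n X" and Y: "lin_subspace n Y" and sub: "Y \<subset> X"
  shows "pivots Y \<subset> pivots X"
proof -
  have carr: "v \<in> carrier_vec n" if "v \<in> X" for v
    using X that by (auto simp: lin_subspace_def)
  obtain x where x: "x \<in> X" "x \<notin> Y"
    and least: "\<And>w. w \<in> X \<Longrightarrow> w \<notin> Y \<Longrightarrow> height x \<le> height w"
    using ex_has_least_nat[of "\<lambda>v. v \<in> X \<and> v \<notin> Y" _ height] sub by blast
  have "x \<noteq> 0\<^sub>v n" using x Y by (auto simp: lin_subspace_def)
  then obtain k where k: "height x = Suc k"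
    using height_pos carr x gr0_implies_Suc by blast
  have "k \<notin> pivots Y"
  proof
    assume "k \<in> pivots Y"
    then obtain y where y: "y \<in> Y" "height y = Suc k" by (auto simp: pivots_def)
    have yk: "vec_index y k \<noteq> 0" using height_Suc_nonzero y by blast
    define c where "c = - vec_index x k / vec_index y k"
    define z where "z = x + c \<cdot>\<^sub>v y"
    have yc: "y \<in> carrier_vec n" and xc: "x \<in> carrier_vec n" using carr y sub x by auto
    have zX: "z \<in> X" unfolding z_def using lin_subspace_lincomb[OF X] x y sub by blast
    have "x = z + (- c) \<cdot>\<^sub>v y" using xc yc by (intro eq_vecI) (auto simp: z_def)
    then have "z \<notin> Y" using lin_subspace_lincomb[OF Y] x y by metis
    moreover have "height z \<le> k"
      unfolding height_le_iff
    proof (intro allI impI)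
      fix j assume "j < dim_vec z" and kj: "k \<le> j"
      then have j: "j < n" using yc by (simp add: z_def)
      show "vec_index z j = 0"
      proof (cases "j = k")
        case True
        then show ?thesis using j xc yc yk by (simp add: z_def c_def)
      next
        case False
        then have "vec_index x j = 0" "vec_index y j = 0"
          using height_le_iff[of x "Suc k"] height_le_iff[of y "Suc k"] j xc yc kj k y by auto
        then show ?thesis using j xc yc by (simp add: z_def)
      qed
    qed
    ultimately show False using least zX k by fastforce
  qed
  moreover have "k \<in> pivots X" using k x by (auto simp: pivots_def)
  moreover have "pivots Y \<subseteq> pivots X" using sub by (auto simp: pivots_def)
  ultimately show ?thesis by blast
qed

text \<open>In a nonzero invariant subspace \<open>Y\<close> with fewest pivots, each member
  \<open>A\<close> has an eigenvector. The eigenspace of \<open>A\<close> within \<open>Y\<close> is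
  invariant under everything commuting with \<open>A\<close>, so by minimality it is all of
  \<open>Y\<close>. Hence every member acts on \<open>Y\<close> as a scalar, and any nonzero vector
  of \<open>Y\<close> will do.\<close>

lemma commuting_common_eigenvector:
  fixes \<A> :: "complex mat set"
  assumes carr: "\<A> \<subseteq> carrier_mat n n"
    and comm: "\<And>A B. A \<in> \<A> \<Longrightarrow> B \<in> \<A> \<Longrightarrow> A * B = B * A"
    and X: "lin_subspace n X"
    and inv: "\<And>A v. A \<in> \<A> \<Longrightarrow> v \<in> X \<Longrightarrow> A *\<^sub>v v \<in> X"
    and nz: "\<exists>v\<in>X. v \<noteq> 0\<^sub>v n"
  obtains v where "v \<in> X" "v \<noteq> 0\<^sub>v n" "\<And>A. A \<in> \<A> \<Longrightarrow> \<exists>c. A *\<^sub>v v = c \<cdot>\<^sub>v v"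
proof -
  define good where "good Y \<longleftrightarrow> Y \<subseteq> X \<and> lin_subspace n Y \<and> (\<forall>A\<in>\<A>. \<forall>v\<in>Y. A *\<^sub>v v \<in> Y)
    \<and> (\<exists>v\<in>Y. v \<noteq> 0\<^sub>v n)" for Y
  have "good X" using X inv nz by (auto simp: good_def)
  then obtain Y where Y: "good Y" and least: "\<And>Z. good Z \<Longrightarrow> card (pivots Y) \<le> card (pivots Z)"
    using ex_has_least_nat[of good X "\<lambda>Y. card (pivots Y)"] by blast
  have Ysub: "lin_subspace n Y" using Y by (simp add: good_def)
  have Yc: "v \<in> carrier_vec n" if "v \<in> Y" for v
    using Ysub that by (auto simp: lin_subspace_def)
  obtain v where v: "v \<in> Y" "v \<noteq> 0\<^sub>v n" using Y by (auto simp: good_def)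
  have "\<exists>c. A *\<^sub>v v = c \<cdot>\<^sub>v v" if A: "A \<in> \<A>" for A
  proof -
    have Ac: "A \<in> carrier_mat n n" using A carr by auto
    obtain u c where u: "u \<in> Y" "u \<noteq> 0\<^sub>v n" "A *\<^sub>v u = c \<cdot>\<^sub>v u"
      using invariant_subspace_eigenvector[OF Ac Ysub] Y A by (auto simp: good_def)
    define Z where "Z = {w \<in> Y. A *\<^sub>v w = c \<cdot>\<^sub>v w}"
    have "lin_subspace n Z"
      using Ysub Ac
      by (auto simp: lin_subspace_def Z_def subset_iff mult_add_distrib_mat_vec[of _ n n]
          mult_mat_vec[of _ n n] smult_add_distrib_vec[of _ n] smult_smult_assoc mult.commute)
    moreover have "B *\<^sub>v w \<in> Z" if B: "B \<in> \<A>" and w: "w \<in> Z" for B w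
    proof -
      have wY: "w \<in> Y" and Aw: "A *\<^sub>v w = c \<cdot>\<^sub>v w" using w by (auto simp: Z_def)
      have Bc: "B \<in> carrier_mat n n" using B carr by auto
      have "A *\<^sub>v (B *\<^sub>v w) = (A * B) *\<^sub>v w" using Ac Bc Yc[OF wY] by simp
      also have "\<dots> = B *\<^sub>v (A *\<^sub>v w)" using comm[OF A B] Ac Bc Yc[OF wY] by simp
      also have "\<dots> = c \<cdot>\<^sub>v (B *\<^sub>v w)" using Aw mult_mat_vec[OF Bc Yc[OF wY]] by simp
      finally show ?thesis using Y B wY by (auto simp: Z_def good_def)
    qed
    ultimately have "good Z" using Y u by (auto simp: good_def Z_def)
    have "Z = Y"
    proof (rule ccontr)
      assume "Z \<noteq> Y"
      then have "pivots Z \<subset> pivots Y"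
        using pivots_strict_mono[OF Ysub \<open>lin_subspace n Z\<close>] by (auto simp: Z_def)
      then have "card (pivots Z) < card (pivots Y)"
        using pivots_subset[OF Ysub] by (meson finite_lessThan finite_subset psubset_card_mono)
      with least[OF \<open>good Z\<close>] show False by simp
    qed
    with v show ?thesis by (auto simp: Z_def)
  qed
  moreover have "v \<in> X" using v Y by (auto simp: good_def)
  ultimately show ?thesis using that v by blast
qed

text \<open>The orthogonal complement \<open>X\<close> of the given vectors is invariant because
  \<open>A\<close> moves to the other side of the inner product as its adjoint, which is again in
  the family and has each \<open>u i\<close> as an eigenvector. A common eigenvector in
  \<open>X\<close> is then normalized.\<close>

lemma extend_orthonormal_eigenvectors:
  fixes \<A> :: "complex mat set"
  assumes carr: "\<A> \<subseteq> carrier_mat n n"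
    and comm: "\<And>A B. A \<in> \<A> \<Longrightarrow> B \<in> \<A> \<Longrightarrow> A * B = B * A"
    and adj: "\<And>A. A \<in> \<A> \<Longrightarrow> mat_adjoint A \<in> \<A>"
    and kn: "k < n"
    and u: "\<And>i. i < k \<Longrightarrow> u i \<in> carrier_vec n"
    and eig: "\<And>A i. A \<in> \<A> \<Longrightarrow> i < k \<Longrightarrow> \<exists>c. A *\<^sub>v u i = c \<cdot>\<^sub>v u i"
  shows "\<exists>w\<in>carrier_vec n. w \<bullet>c w = 1 \<and> (\<forall>i<k. w \<bullet>c u i = 0) \<and>
    (\<forall>A\<in>\<A>. \<exists>c. A *\<^sub>v w = c \<cdot>\<^sub>v w)"
proof -
  define X where "X = {v \<in> carrier_vec n. \<forall>i<k. v \<bullet>c u i = 0}"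
  have X: "lin_subspace n X"
    using u by (auto simp: lin_subspace_def X_def add_scalar_prod_distrib[of _ n])
  have inv: "A *\<^sub>v v \<in> X" if A: "A \<in> \<A>" and v: "v \<in> X" for A v
  proof -
    have Ac: "A \<in> carrier_mat n n" using A carr by auto
    have vc: "v \<in> carrier_vec n" using v by (auto simp: X_def)
    have "(A *\<^sub>v v) \<bullet>c u i = 0" if i: "i < k" for i
    proof -
      obtain c where "mat_adjoint A *\<^sub>v u i = c \<cdot>\<^sub>v u i" using eig[OF adj[OF A] i] by blast
      then have "(A *\<^sub>v v) \<bullet>c u i = v \<bullet>c (c \<cdot>\<^sub>v u i)"
        using inner_mult_mat_vec[OF Ac vc u[OF i]] by simp
      also have "\<dots> = cnj c * (v \<bullet>c u i)"
        using vc u[OF i] by (simp add: conjugate_smult_vec)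
      also have "\<dots> = 0" using v i by (simp add: X_def)
      finally show ?thesis .
    qed
    then show ?thesis using mult_mat_vec_carrier[OF Ac vc] by (simp add: X_def)
  qed
  have nz: "\<exists>v\<in>X. v \<noteq> 0\<^sub>v n"
  proof -
    \<comment> \<open>Replaces a dimension count: the rows of \<open>M\<close> are the conjugates of
      the \<open>u i\<close>, padded with zeros. Row \<open>k\<close> is zero, so \<open>M\<close>
      is singular, and a kernel vector is orthogonal to every \<open>u i\<close>.\<close>
    define M where "M = Matrix.mat n n (\<lambda>(i, j). if i < k then cnj (vec_index (u i) j) else 0)"
    have M: "M \<in> carrier_mat n n" by (simp add: M_def)
    have "Determinant.det M = 0"
      using kn by (subst laplace_expansion_row[OF M kn]) (simp add: M_def)
    then obtain v where v: "v \<in> carrier_vec n" "v \<noteq> 0\<^sub>v n" "M *\<^sub>v v = 0\<^sub>v n"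
      using det_0_iff_vec_prod_zero[OF M] by blast
    have "v \<bullet>c u i = 0" if i: "i < k" for i
    proof -
      have "v \<bullet>c u i = (\<Sum>j\<in>{0..<n}. cnj (vec_index (u i) j) * vec_index v j)"
        using u[OF i] v(1) by (auto simp: scalar_prod_def intro!: sum.cong)
      also have "\<dots> = vec_index (M *\<^sub>v v) i"
        using i kn v(1) by (simp add: M_def scalar_prod_def)
      finally show ?thesis using v(3) i kn by simp
    qed
    with v show ?thesis by (auto simp: X_def)
  qed
  obtain v where v: "v \<in> X" "v \<noteq> 0\<^sub>v n" and veig: "\<And>A. A \<in> \<A> \<Longrightarrow> \<exists>c. A *\<^sub>v v = c \<cdot>\<^sub>v v"
    using commuting_common_eigenvector[OF carr comm X inv nz] by blast
  have vc: "v \<in> carrier_vec n" using v by (simp add: X_def)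
  have pos: "v \<bullet>c v > 0" using v vc by simp
  define r where "r = Re (v \<bullet>c v)"
  have r: "v \<bullet>c v = complex_of_real r" "r > 0"
    using pos by (auto simp: r_def less_complex_def complex_eq_iff)
  define a where "a = complex_of_real (1 / sqrt r)"
  define w where "w = a \<cdot>\<^sub>v v"
  have wc: "w \<in> carrier_vec n" using vc by (simp add: w_def)
  have "w \<bullet>c w = a * cnj a * (v \<bullet>c v)"
    using vc by (simp add: w_def conjugate_smult_vec)
  also have "\<dots> = complex_of_real (1 / sqrt r * (1 / sqrt r) * r)"
    unfolding r(1) a_def by (simp only: complex_cnj_complex_of_real of_real_mult)
  also have "1 / sqrt r * (1 / sqrt r) * r = 1" using r(2) by simp
  finally have "w \<bullet>c w = 1" by simp
  moreover have "w \<bullet>c u i = 0" if "i < k" for i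
    using v vc u[OF that] that by (simp add: w_def X_def)
  moreover have "\<exists>c. A *\<^sub>v w = c \<cdot>\<^sub>v w" if A: "A \<in> \<A>" for A
  proof -
    obtain c where c: "A *\<^sub>v v = c \<cdot>\<^sub>v v" using veig[OF A] by blast
    have "A \<in> carrier_mat n n" using A carr by auto
    from mult_mat_vec[OF this vc, of a] have "A *\<^sub>v w = c \<cdot>\<^sub>v w"
      by (simp add: w_def c smult_smult_assoc mult.commute)
    then show ?thesis by blast
  qed
  ultimately show ?thesis using wc by blast
qed

lemma orthonormal_eigenvectors:
  fixes \<A> :: "complex mat set"
  assumes carr: "\<A> \<subseteq> carrier_mat n n"
    and comm: "\<And>A B. A \<in> \<A> \<Longrightarrow> B \<in> \<A> \<Longrightarrow> A * B = B * A"
    and adj: "\<And>A. A \<in> \<A> \<Longrightarrow> mat_adjoint A \<in> \<A>"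
    and "k \<le> n"
  shows "\<exists>u. (\<forall>i<k. u i \<in> carrier_vec n \<and> (\<forall>A\<in>\<A>. \<exists>c. A *\<^sub>v u i = c \<cdot>\<^sub>v u i)) \<and>
     (\<forall>i<k. \<forall>j<k. u i \<bullet>c u j = (if i = j then 1 else 0))"
  using \<open>k \<le> n\<close>
proof (induction k)
  case (Suc k)
  then have "\<exists>u. (\<forall>i<k. u i \<in> carrier_vec n \<and> (\<forall>A\<in>\<A>. \<exists>c. A *\<^sub>v u i = c \<cdot>\<^sub>v u i)) \<and>
     (\<forall>i<k. \<forall>j<k. u i \<bullet>c u j = (if i = j then 1 else 0))" by simp
  then obtain u where ex: "\<forall>i<k. u i \<in> carrier_vec n \<and> (\<forall>A\<in>\<A>. \<exists>c. A *\<^sub>v u i = c \<cdot>\<^sub>v u i)"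
    and orth: "\<forall>i<k. \<forall>j<k. u i \<bullet>c u j = (if i = j then 1 else 0)" by blast
  then have u: "\<And>i. i < k \<Longrightarrow> u i \<in> carrier_vec n"
    "\<And>A i. A \<in> \<A> \<Longrightarrow> i < k \<Longrightarrow> \<exists>c. A *\<^sub>v u i = c \<cdot>\<^sub>v u i" by blast+
  have kn: "k < n" using Suc by simp
  have "\<exists>w\<in>carrier_vec n. w \<bullet>c w = 1 \<and> (\<forall>i<k. w \<bullet>c u i = 0) \<and>
    (\<forall>A\<in>\<A>. \<exists>c. A *\<^sub>v w = c \<cdot>\<^sub>v w)"
    using carr comm adj kn u by (rule extend_orthonormal_eigenvectors)
  then obtain w where w: "w \<in> carrier_vec n" "w \<bullet>c w = 1" "\<And>i. i < k \<Longrightarrow> w \<bullet>c u i = 0"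
    "\<And>A. A \<in> \<A> \<Longrightarrow> \<exists>c. A *\<^sub>v w = c \<cdot>\<^sub>v w" by blast
  have uw: "u i \<bullet>c w = 0" if i: "i < k" for i
  proof -
    have "u i \<bullet>c w = conjugate (conjugate (u i) \<bullet> w)"
      using u(1)[OF i] w(1) by (rule conjugate_conjugate_sprod[symmetric])
    also have "\<dots> = conjugate (w \<bullet>c u i)"
      using conjugate_vec_sprod_comm[OF w(1) u(1)[OF i]] by simp
    finally show ?thesis using w(3)[OF i] by simp
  qed
  have "(\<forall>i<Suc k. (u(k := w)) i \<in> carrier_vec n \<and>
      (\<forall>A\<in>\<A>. \<exists>c. A *\<^sub>v (u(k := w)) i = c \<cdot>\<^sub>v (u(k := w)) i)) \<and>
     (\<forall>i<Suc k. \<forall>j<Suc k. (u(k := w)) i \<bullet>c (u(k := w)) j = (if i = j then 1 else 0))"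
    using u w uw orth by (auto simp: less_Suc_eq)
  then show ?case by blast
qed simp

section \<open>Unitary matrices and diagonal form\<close>

definition unitary_mat :: "nat \<Rightarrow> complex mat \<Rightarrow> bool" where
  "unitary_mat n U \<longleftrightarrow> U \<in> carrier_mat n n \<and> mat_adjoint U * U = 1\<^sub>m n \<and> U * mat_adjoint U = 1\<^sub>m n"

lemma unitary_matI:
  assumes "U \<in> carrier_mat n n" "mat_adjoint U * U = 1\<^sub>m n"
  shows "unitary_mat n U"
  using assms mat_mult_left_right_inverse[OF mat_adjoint_carrier[OF assms(1)] assms(1,2)]
  by (simp add: unitary_mat_def)

text \<open>Only the values \<open>f k\<close> with \<open>k < n\<close> enter; for unitary
  \<open>U\<close> they are the eigenvalues belonging to the columns of \<open>U\<close>. With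
  \<open>f\<close> ranging over all functions, \<open>range (spectral_mat n U)\<close> is the
  algebra of all matrices diagonal in that basis.\<close>

definition spectral_mat :: "nat \<Rightarrow> complex mat \<Rightarrow> (nat \<Rightarrow> complex) \<Rightarrow> complex mat" where
  "spectral_mat n U f = U * mat_diag n f * mat_adjoint U"

theorem simultaneous_unitary_diagonalization:
  fixes \<A> :: "complex mat set"
  assumes carr: "\<A> \<subseteq> carrier_mat n n"
    and comm: "\<And>A B. A \<in> \<A> \<Longrightarrow> B \<in> \<A> \<Longrightarrow> A * B = B * A"
    and adj: "\<And>A. A \<in> \<A> \<Longrightarrow> mat_adjoint A \<in> \<A>"
  obtains U where "unitary_mat n U" "\<A> \<subseteq> range (spectral_mat n U)"
proof -
  have "\<exists>u. (\<forall>i<n. u i \<in> carrier_vec n \<and> (\<forall>A\<in>\<A>. \<exists>c. A *\<^sub>v u i = c \<cdot>\<^sub>v u i)) \<and>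
     (\<forall>i<n. \<forall>j<n. u i \<bullet>c u j = (if i = j then 1 else 0))"
    using carr comm adj order_refl by (rule orthonormal_eigenvectors)
  then obtain u where "\<forall>i<n. u i \<in> carrier_vec n \<and> (\<forall>A\<in>\<A>. \<exists>c. A *\<^sub>v u i = c \<cdot>\<^sub>v u i)"
    and orth: "\<forall>i<n. \<forall>j<n. u i \<bullet>c u j = (if i = j then 1 else 0)" by blast
  then have u: "\<And>i. i < n \<Longrightarrow> u i \<in> carrier_vec n"
    and eig: "\<And>A i. A \<in> \<A> \<Longrightarrow> i < n \<Longrightarrow> \<exists>c. A *\<^sub>v u i = c \<cdot>\<^sub>v u i" by blast+
  define U where "U = Matrix.mat n n (\<lambda>(i, j). vec_index (u j) i)"
  have U: "U \<in> carrier_mat n n" by (simp add: U_def)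
  have "mat_adjoint U * U = 1\<^sub>m n"
  proof (rule eq_matI)
    fix i j assume "i < dim_row (1\<^sub>m n :: complex mat)" "j < dim_col (1\<^sub>m n :: complex mat)"
    then have ij: "i < n" "j < n" by auto
    have "(mat_adjoint U * U) $$ (i, j)
        = (\<Sum>l\<in>{0..<n}. cnj (vec_index (u i) l) * vec_index (u j) l)"
      using ij U by (simp add: scalar_prod_def index_mat_adjoint) (simp add: U_def)
    also have "\<dots> = (\<Sum>l\<in>{0..<n}. vec_index (u j) l * cnj (vec_index (u i) l))"
      by (intro sum.cong refl mult.commute)
    also have "\<dots> = u j \<bullet>c u i" using u[OF ij(1)] u[OF ij(2)] by (simp add: scalar_prod_def)
    finally show "(mat_adjoint U * U) $$ (i, j) = 1\<^sub>m n $$ (i, j)" using orth ij by simp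
  qed (use U in auto)
  with U have uni: "unitary_mat n U" by (rule unitary_matI)
  have "A \<in> range (spectral_mat n U)" if A: "A \<in> \<A>" for A
  proof -
    have Ac: "A \<in> carrier_mat n n" using A carr by auto
    obtain c where c: "\<And>i. i < n \<Longrightarrow> A *\<^sub>v u i = c i \<cdot>\<^sub>v u i"
      using eig[OF A] by metis
    have AU: "A * U = U * mat_diag n c"
    proof (rule eq_matI)
      fix i j assume "i < dim_row (U * mat_diag n c)" "j < dim_col (U * mat_diag n c)"
      then have ij: "i < n" "j < n" using U by (auto simp: mat_diag_def)
      have "(A * U) $$ (i, j) = vec_index (A *\<^sub>v u j) i"
        using Ac ij u[OF ij(2)] by (simp add: U_def scalar_prod_def)
      also have "\<dots> = (U * mat_diag n c) $$ (i, j)"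
        using u[OF ij(2)] ij by (simp add: c mat_diag_mult_right[OF U]) (simp add: U_def)
      finally show "(A * U) $$ (i, j) = (U * mat_diag n c) $$ (i, j)" .
    qed (use Ac U in \<open>auto simp: mat_diag_def\<close>)
    have "A = A * (U * mat_adjoint U)" using uni Ac by (simp add: unitary_mat_def)
    also have "\<dots> = (A * U) * mat_adjoint U"
      using Ac U mat_adjoint_carrier[OF U] by (rule assoc_mult_mat[symmetric])
    finally show ?thesis unfolding AU spectral_mat_def by blast
  qed
  then have "\<A> \<subseteq> range (spectral_mat n U)" by (rule subsetI)
  with uni show ?thesis by (rule that)
qed

section \<open>Maximal contexts\<close>

lemma unitary_mat_carrier: "unitary_mat n U \<Longrightarrow> U \<in> carrier_mat n n"
  by (simp add: unitary_mat_def)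

lemma unitary_mat_adjoint: "unitary_mat n U \<Longrightarrow> unitary_mat n (mat_adjoint U)"
  by (auto simp: unitary_mat_def)

lemma unitary_mat_mult:
  assumes "unitary_mat n U" "unitary_mat n W"
  shows "unitary_mat n (U * W)"
proof (rule unitary_matI)
  have U: "U \<in> carrier_mat n n" and W: "W \<in> carrier_mat n n"
    using assms by (auto simp: unitary_mat_def)
  show "U * W \<in> carrier_mat n n" using U W by (rule mult_carrier_mat)
  note assoc = assoc_mult_mat[of _ n n _ n _ n] mult_carrier_mat[of _ n n _ n]
    mat_adjoint_carrier[OF U] mat_adjoint_carrier[OF W]
  have "mat_adjoint (U * W) * (U * W) = mat_adjoint W * (mat_adjoint U * U) * W"
    unfolding mat_adjoint_mult[OF U W] using U W by (simp only: assoc)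
  also have "\<dots> = 1\<^sub>m n" using assms W mat_adjoint_carrier[OF W] by (simp add: unitary_mat_def)
  finally show "mat_adjoint (U * W) * (U * W) = 1\<^sub>m n" .
qed

lemma sum_unitary_cols:
  assumes "unitary_mat n U" "k < n" "l < n"
  shows "(\<Sum>i<n. U $$ (i, l) * cnj (U $$ (i, k))) = (if k = l then 1 else 0)"
proof -
  have "(\<Sum>i<n. U $$ (i, l) * cnj (U $$ (i, k))) = (mat_adjoint U * U) $$ (k, l)"
    using assms unitary_mat_carrier[OF assms(1)]
    by (simp add: scalar_prod_def index_mat_adjoint mult.commute atLeast0LessThan)
  then show ?thesis using assms by (simp add: unitary_mat_def)
qed

lemma sum_unitary_rows:
  assumes "unitary_mat n U" "k < n" "l < n"
  shows "(\<Sum>i<n. U $$ (k, i) * cnj (U $$ (l, i))) = (if k = l then 1 else 0)"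
proof -
  have "(\<Sum>i<n. U $$ (k, i) * cnj (U $$ (l, i))) = (U * mat_adjoint U) $$ (k, l)"
    using assms unitary_mat_carrier[OF assms(1)]
    by (simp add: scalar_prod_def index_mat_adjoint atLeast0LessThan)
  then show ?thesis using assms by (simp add: unitary_mat_def)
qed

section \<open>Calculus of matrices diagonal in a fixed basis\<close>

lemma spectral_mat_carrier:
  "U \<in> carrier_mat n n \<Longrightarrow> spectral_mat n U f \<in> carrier_mat n n"
  unfolding spectral_mat_def by (intro mult_carrier_mat[of _ n n _ n] mat_diag_dim mat_adjoint_carrier)

lemma index_spectral_mat:
  assumes U: "U \<in> carrier_mat n n" and ij: "i < n" "j < n"
  shows "spectral_mat n U f $$ (i, j) = (\<Sum>k<n. U $$ (i, k) * f k * cnj (U $$ (j, k)))"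
  using assms unfolding spectral_mat_def mat_diag_mult_right[OF U]
  by (simp add: scalar_prod_def index_mat_adjoint atLeast0LessThan)

lemma spectral_mat_eqI:
  assumes "U \<in> carrier_mat n n" "A \<in> carrier_mat n n"
    and "\<And>i j. i < n \<Longrightarrow> j < n \<Longrightarrow> A $$ (i, j) = (\<Sum>k<n. U $$ (i, k) * f k * cnj (U $$ (j, k)))"
  shows "A = spectral_mat n U f"
  using assms spectral_mat_carrier[OF assms(1), of f]
  by (intro eq_matI) (auto simp: index_spectral_mat)

context
  fixes n :: nat and U :: "complex mat"
  assumes U: "U \<in> carrier_mat n n"
begin

lemma spectral_mat_cong:
  "(\<And>k. k < n \<Longrightarrow> f k = g k) \<Longrightarrow> spectral_mat n U f = spectral_mat n U g"
  using U spectral_mat_carrier[OF U]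
  by (intro spectral_mat_eqI) (auto simp: index_spectral_mat intro!: sum.cong)

lemma spectral_mat_add:
  "spectral_mat n U f + spectral_mat n U g = spectral_mat n U (\<lambda>k. f k + g k)"
  using U spectral_mat_carrier[OF U, of f] spectral_mat_carrier[OF U, of g]
  by (intro spectral_mat_eqI) (auto simp: index_spectral_mat algebra_simps sum.distrib)

lemma spectral_mat_smult:
  "c \<cdot>\<^sub>m spectral_mat n U f = spectral_mat n U (\<lambda>k. c * f k)"
  using U spectral_mat_carrier[OF U, of f]
  by (intro spectral_mat_eqI) (auto simp: index_spectral_mat algebra_simps sum_distrib_left)

lemma spectral_mat_zero: "spectral_mat n U (\<lambda>k. 0) = 0\<^sub>m n n"
  using U by (intro spectral_mat_eqI[symmetric]) auto

lemma spectral_mat_adjoint: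
  "mat_adjoint (spectral_mat n U f) = spectral_mat n U (\<lambda>k. cnj (f k))"
  using U spectral_mat_carrier[OF U, of f]
  by (intro spectral_mat_eqI) (auto simp: index_mat_adjoint index_spectral_mat mult.commute mult.left_commute)

end

lemma adjoint_spectral_mat_mult:
  assumes "unitary_mat n U"
  shows "mat_adjoint U * spectral_mat n U f * U = mat_diag n f"
proof -
  have U: "U \<in> carrier_mat n n" and UU: "mat_adjoint U * U = 1\<^sub>m n"
    using assms by (auto simp: unitary_mat_def)
  note assoc = assoc_mult_mat[of _ n n _ n _ n] mult_carrier_mat[of _ n n _ n]
    mat_adjoint_carrier[OF U] mat_diag_dim
  have "mat_adjoint U * spectral_mat n U f * U
      = (mat_adjoint U * U) * mat_diag n f * (mat_adjoint U * U)"
    unfolding spectral_mat_def using U by (simp only: assoc)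
  also have "\<dots> = mat_diag n f"
    unfolding UU by (simp add: left_mult_one_mat[of _ n n] right_mult_one_mat[of _ n n])
  finally show ?thesis .
qed

lemma spectral_mat_eq_iff:
  assumes "unitary_mat n U"
  shows "spectral_mat n U f = spectral_mat n U g \<longleftrightarrow> (\<forall>k<n. f k = g k)"
proof
  assume "spectral_mat n U f = spectral_mat n U g"
  then have eq: "mat_diag n f = mat_diag n g"
    using adjoint_spectral_mat_mult[OF assms] by metis
  show "\<forall>k<n. f k = g k"
  proof (intro allI impI)
    fix k assume "k < n"
    then show "f k = g k"
      using arg_cong[OF eq, of "\<lambda>M. M $$ (k, k)"] by (simp add: mat_diag_def)
  qed
qed (use spectral_mat_cong[OF unitary_mat_carrier[OF assms]] in blast)

lemma spectral_mat_mult: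
  assumes "unitary_mat n U"
  shows "spectral_mat n U f * spectral_mat n U g = spectral_mat n U (\<lambda>k. f k * g k)"
proof -
  have U: "U \<in> carrier_mat n n" and UU: "mat_adjoint U * U = 1\<^sub>m n"
    using assms by (auto simp: unitary_mat_def)
  note assoc = assoc_mult_mat[of _ n n _ n _ n] mult_carrier_mat[of _ n n _ n]
    mat_adjoint_carrier[OF U] mat_diag_dim
  have "spectral_mat n U f * spectral_mat n U g
      = U * (mat_diag n f * ((mat_adjoint U * U) * mat_diag n g)) * mat_adjoint U"
    unfolding spectral_mat_def using U by (simp only: assoc)
  also have "(mat_adjoint U * U) * mat_diag n g = mat_diag n g"
    unfolding UU by (simp add: left_mult_one_mat[of _ n n])
  finally show ?thesis by (simp add: spectral_mat_def)
qed

lemma spectral_mat_one: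
  assumes "unitary_mat n U"
  shows "spectral_mat n U (\<lambda>k. 1) = 1\<^sub>m n"
  using assms by (simp add: spectral_mat_def unitary_mat_def right_mult_one_mat[of _ n n])

lemma quantum_context_spectral:
  assumes U: "unitary_mat n U" and n: "2 \<le> n"
  shows "quantum_context n (range (spectral_mat n U))"
proof -
  note Uc = unitary_mat_carrier[OF U]
  have "commutative_star_subalgebra n (range (spectral_mat n U))"
    using spectral_mat_carrier[OF Uc]
    by (auto simp: commutative_star_subalgebra_def spectral_mat_add[OF Uc] spectral_mat_smult[OF Uc]
        spectral_mat_mult[OF U] spectral_mat_adjoint[OF Uc] mult.commute)
  moreover have "1\<^sub>m n \<in> range (spectral_mat n U)"
    using spectral_mat_one[OF U] by (metis rangeI)
  moreover have "range (spectral_mat n U) \<noteq> range (\<lambda>c. c \<cdot>\<^sub>m 1\<^sub>m n)"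
  proof
    \<comment> \<open>A nonscalar element: \<open>?f\<close> differs at the indices \<open>0\<close>
      and \<open>1\<close>, both below \<open>n\<close> because \<open>2 \<le> n\<close>.\<close>
    let ?f = "\<lambda>k::nat. if k = 0 then 1 else (0::complex)"
    assume "range (spectral_mat n U) = range (\<lambda>c. c \<cdot>\<^sub>m 1\<^sub>m n)"
    then obtain c where "spectral_mat n U ?f = c \<cdot>\<^sub>m 1\<^sub>m n" by blast
    also have "\<dots> = spectral_mat n U (\<lambda>k. c)"
      unfolding spectral_mat_one[OF U, symmetric] spectral_mat_smult[OF Uc] by simp
    finally have "\<forall>k<n. ?f k = c" unfolding spectral_mat_eq_iff[OF U] .
    from this[rule_format, of 0] this[rule_format, of 1] n show False by simp
  qed
  ultimately show ?thesis by (simp add: quantum_context_def)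
qed

text \<open>Entry by entry, commutation reads \<open>B $$ (i, j) * d j = d i * B $$ (i, j)\<close>,
  so distinct values of \<open>d\<close> leave no room for a nonzero entry off the diagonal.\<close>

lemma commute_distinct_diag_imp_diag:
  fixes B :: "complex mat"
  assumes B: "B \<in> carrier_mat n n" and d: "inj_on d {..<n}"
    and comm: "B * mat_diag n d = mat_diag n d * B"
  shows "B = mat_diag n (\<lambda>i. B $$ (i, i))"
proof (rule eq_matI)
  fix i j
  assume "i < dim_row (mat_diag n (\<lambda>i. B $$ (i, i)))" "j < dim_col (mat_diag n (\<lambda>i. B $$ (i, i)))"
  then have ij: "i < n" "j < n" by (auto simp: mat_diag_def)
  have "B $$ (i, j) * d j = d i * B $$ (i, j)"
    using arg_cong[OF comm, of "\<lambda>M. M $$ (i, j)"] ij B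
    by (simp add: mat_diag_mult_left[OF B] mat_diag_mult_right[OF B])
  then have "B $$ (i, j) = 0 \<or> i = j"
    using inj_onD[OF d, of i j] ij by (auto simp: mult.commute)
  then show "B $$ (i, j) = mat_diag n (\<lambda>i. B $$ (i, i)) $$ (i, j)"
    using ij by (auto simp: mat_diag_def)
qed (use B in \<open>auto simp: mat_diag_def\<close>)

lemma maximal_context_spectral:
  assumes U: "unitary_mat n U" and n: "2 \<le> n"
  shows "maximal_context n (range (spectral_mat n U))"
  unfolding maximal_context_def
proof (intro conjI allI impI)
  note Uc = unitary_mat_carrier[OF U]
  note Uac = mat_adjoint_carrier[OF Uc]
  show "quantum_context n (range (spectral_mat n U))" using assms by (rule quantum_context_spectral)
  fix W assume "quantum_context n W \<and> range (spectral_mat n U) \<subseteq> W"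
  then have W: "commutative_star_subalgebra n W" and sub: "range (spectral_mat n U) \<subseteq> W"
    by (auto simp: quantum_context_def)
  have "A \<in> range (spectral_mat n U)" if A: "A \<in> W" for A
  proof -
    have Ac: "A \<in> carrier_mat n n" using W A by (auto simp: commutative_star_subalgebra_def)
    \<comment> \<open>Commuting with one element of distinct eigenvalues already forces \<open>A\<close> to be diagonal in the basis \<open>U\<close>.\<close>
    let ?D = "mat_diag n of_nat :: complex mat"
    have comm: "A * spectral_mat n U of_nat = spectral_mat n U of_nat * A"
      using W A sub unfolding commutative_star_subalgebra_def by blast
    note assoc = assoc_mult_mat[of _ n n _ n _ n] mult_carrier_mat[of _ n n _ n] mat_diag_dim
    define B where "B = mat_adjoint U * A * U"
    have B: "B \<in> carrier_mat n n" unfolding B_def using Uc Uac Ac by (simp only: assoc)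
    have "U * B * mat_adjoint U = (U * mat_adjoint U) * A * (U * mat_adjoint U)"
      unfolding B_def using Uc Uac Ac by (simp only: assoc)
    also have "\<dots> = A" using U Ac by (simp add: unitary_mat_def)
    finally have AB: "A = U * B * mat_adjoint U" ..
    have D: "?D = mat_adjoint U * spectral_mat n U of_nat * U"
      using adjoint_spectral_mat_mult[OF U] by simp
    \<comment> \<open>Cancels or inserts \<open>U * mat_adjoint U\<close> in the middle of a
      product, which carries the commutation relation of \<open>A\<close> over to \<open>B\<close>
      and \<open>?D\<close>.\<close>
    have UU: "X * U * (mat_adjoint U * Y) = X * Y"
      if X: "X \<in> carrier_mat n n" and Y: "Y \<in> carrier_mat n n" for X Y
    proof -
      have "X * U * (mat_adjoint U * Y) = X * (U * mat_adjoint U) * Y"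
        using X Y Uc Uac by (simp only: assoc)
      then show ?thesis using U X by (simp add: unitary_mat_def)
    qed
    note Sc = spectral_mat_carrier[OF Uc, of of_nat]
    have "B * ?D = (mat_adjoint U * A) * U * (mat_adjoint U * (spectral_mat n U of_nat * U))"
      unfolding D B_def using Uc Uac Ac Sc by (simp only: assoc)
    also have "\<dots> = mat_adjoint U * (A * spectral_mat n U of_nat) * U"
      using Uc Uac Ac Sc by (subst UU) (simp_all only: assoc)
    also have "\<dots> = (mat_adjoint U * spectral_mat n U of_nat) * (A * U)"
      unfolding comm using Uc Uac Ac Sc by (simp only: assoc)
    also have "\<dots> = (mat_adjoint U * spectral_mat n U of_nat) * U * (mat_adjoint U * (A * U))"
      using Uc Uac Ac Sc by (subst UU) (simp_all only: assoc)
    also have "\<dots> = ?D * B"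
      unfolding D B_def using Uc Uac Ac Sc by (simp only: assoc)
    finally have "B = mat_diag n (\<lambda>i. B $$ (i, i))"
      by (intro commute_distinct_diag_imp_diag[OF B]) (auto simp: inj_on_def)
    then have "A = spectral_mat n U (\<lambda>i. B $$ (i, i))" using AB by (simp add: spectral_mat_def)
    then show ?thesis by blast
  qed
  then have "W \<subseteq> range (spectral_mat n U)" by (rule subsetI)
  from this sub show "W = range (spectral_mat n U)" by (rule subset_antisym)
qed

text \<open>Diagonalization gives only an inclusion of \<open>V\<close> in the algebra of a basis;
  as that algebra is itself a context, maximality of \<open>V\<close> makes it an equality.\<close>

lemma maximal_contextE:
  assumes V: "maximal_context n V" and n: "2 \<le> n"
  obtains U where "unitary_mat n U" "V = range (spectral_mat n U)"
proof -
  have W: "commutative_star_subalgebra n V"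
    using V by (simp add: maximal_context_def quantum_context_def)
  obtain U where U: "unitary_mat n U" "V \<subseteq> range (spectral_mat n U)"
  proof (rule simultaneous_unitary_diagonalization[of V n])
    show "V \<subseteq> carrier_mat n n" using W by (simp add: commutative_star_subalgebra_def)
    show "A * B = B * A" if "A \<in> V" "B \<in> V" for A B
      using W that unfolding commutative_star_subalgebra_def by blast
    show "mat_adjoint A \<in> V" if "A \<in> V" for A
      using W that unfolding commutative_star_subalgebra_def by blast
  qed
  have "range (spectral_mat n U) = V"
    using V quantum_context_spectral[OF U(1) n] U(2) unfolding maximal_context_def by blast
  from U(1) this[symmetric] show ?thesis by (rule that)
qed

section \<open>Canonical projections\<close>

lemma smult_smult_mat: "a \<cdot>\<^sub>m (b \<cdot>\<^sub>m A) = (a * b :: 'a :: semigroup_mult) \<cdot>\<^sub>m A"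
  by (rule eq_matI) (simp_all add: mult.assoc)

lemma smult_mat_idem:
  fixes A :: "complex mat"
  assumes "c \<noteq> 0" "c \<cdot>\<^sub>m (c \<cdot>\<^sub>m A) = c \<cdot>\<^sub>m A"
  shows "c \<cdot>\<^sub>m A = A"
proof (rule eq_matI)
  fix i j assume ij: "i < dim_row A" "j < dim_col A"
  have "c * (c * A $$ (i, j)) = c * A $$ (i, j)"
    using arg_cong[OF assms(2), of "\<lambda>M. M $$ (i, j)"] ij by simp
  then show "(c \<cdot>\<^sub>m A) $$ (i, j) = A $$ (i, j)" using assms(1) ij by simp
qed simp_all

text \<open>Expresses that \<open>P\<close> is an atom of \<open>V\<close>. The matrices
  \<open>B\<close> acting on \<open>P\<close> from both sides by one scalar form a subspace
  \<open>N\<close>; it contains \<open>S\<close> by orthogonality and idempotence, hence also the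
  span \<open>V\<close>.\<close>

lemma canonical_projection_mult:
  assumes S: "is_canonical_projections n V S" and B: "B \<in> V" and P: "P \<in> S"
  shows "\<exists>c. P * B = c \<cdot>\<^sub>m P \<and> B * P = c \<cdot>\<^sub>m P"
proof -
  interpret vs: vectorspace class_ring "module_mat TYPE(complex) n n" by (rule matrix_vs)
  have Sc: "S \<subseteq> carrier_mat n n"
    using S by (auto simp: is_canonical_projections_def projection_def)
  define N where "N = {B \<in> carrier_mat n n. \<exists>c. P * B = c \<cdot>\<^sub>m P \<and> B * P = c \<cdot>\<^sub>m P}"
  have Pc: "P \<in> carrier_mat n n" using P Sc by auto
  have "submodule class_ring N (module_mat TYPE(complex) n n)"
  proof (unfold_locales, unfold matrix_vs_simps)
    show "N \<subseteq> carrier_mat n n" by (auto simp: N_def)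
    show "A + B \<in> N" if A: "A \<in> N" and B: "B \<in> N" for A B
    proof -
      from A B obtain a b where ab: "P * A = a \<cdot>\<^sub>m P" "A * P = a \<cdot>\<^sub>m P" "P * B = b \<cdot>\<^sub>m P" "B * P = b \<cdot>\<^sub>m P"
        and c: "A \<in> carrier_mat n n" "B \<in> carrier_mat n n" by (auto simp: N_def)
      have "P * (A + B) = (a + b) \<cdot>\<^sub>m P \<and> (A + B) * P = (a + b) \<cdot>\<^sub>m P"
        using mult_add_distrib_mat[OF Pc c] add_mult_distrib_mat[OF c Pc]
        by (simp add: ab add_smult_distrib_right_mat[OF Pc])
      then show ?thesis using c by (auto simp: N_def)
    qed
    show "0\<^sub>m n n \<in> N"
      using Pc by (auto simp: N_def intro!: exI[of _ 0])
    show "c \<cdot>\<^sub>m A \<in> N" if A: "A \<in> N" for c A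
    proof -
      from A obtain a where ab: "P * A = a \<cdot>\<^sub>m P" "A * P = a \<cdot>\<^sub>m P"
        and Ac: "A \<in> carrier_mat n n" by (auto simp: N_def)
      have "P * (c \<cdot>\<^sub>m A) = (c * a) \<cdot>\<^sub>m P \<and> (c \<cdot>\<^sub>m A) * P = (c * a) \<cdot>\<^sub>m P"
        using mult_smult_distrib[OF Pc Ac] mult_smult_assoc_mat[OF Ac Pc]
        by (simp add: ab smult_smult_mat)
      then show ?thesis using Ac by (auto simp: N_def)
    qed
  qed
  moreover have "S \<subseteq> N"
  proof
    fix Q assume Q: "Q \<in> S"
    then have Qc: "Q \<in> carrier_mat n n" using Sc by auto
    show "Q \<in> N"
    proof (cases "P = Q")
      case True
      have "P * P = 1 \<cdot>\<^sub>m P"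
        using S P by (auto simp: is_canonical_projections_def projection_def)
      then show ?thesis using Qc True unfolding N_def by blast
    next
      case False
      then have "P * Q = 0 \<cdot>\<^sub>m P" "Q * P = 0 \<cdot>\<^sub>m P"
        using S P Q Pc by (auto simp: is_canonical_projections_def)
      then show ?thesis using Qc unfolding N_def by blast
    qed
  qed
  ultimately have "LinearCombinations.module.span class_ring (module_mat TYPE(complex) n n) S \<subseteq> N"
    by (intro vs.span_is_subset)
  then show ?thesis
    using S B by (auto simp: is_canonical_projections_def N_def)
qed

lemma mult_finsum_mat_zero:
  fixes P :: "complex mat"
  assumes "finite S" "S \<subseteq> carrier_mat n n" "P \<in> carrier_mat n n"
    and "\<And>Q. Q \<in> S \<Longrightarrow> P * Q = 0\<^sub>m n n"
  shows "P * finsum (module_mat TYPE(complex) n n) (\<lambda>Q. Q) S = 0\<^sub>m n n"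
proof -
  interpret vs: vectorspace class_ring "module_mat TYPE(complex) n n" by (rule matrix_vs)
  let ?M = "module_mat TYPE(complex) n n"
  have "finsum ?M (\<lambda>Q. Q) S \<in> carrier_mat n n \<and> P * finsum ?M (\<lambda>Q. Q) S = 0\<^sub>m n n"
    using assms
  proof (induction S rule: finite_induct)
    case empty
    then show ?case by (simp add: module_mat_simps)
  next
    case (insert Q S)
    have "finsum ?M (\<lambda>Q. Q) (insert Q S) = Q + finsum ?M (\<lambda>Q. Q) S"
      using insert by (subst vs.finsum_insert) (auto simp: module_mat_simps)
    then show ?case
      using insert by (simp add: mult_add_distrib_mat[of P n n _ n])
  qed
  then show ?thesis by simp
qed

text \<open>Uniqueness of canonical projections, one inclusion at a time. As \<open>S'\<close> sums
  to the identity, some \<open>Q\<close> in \<open>S'\<close> has \<open>P * Q\<close> nonzero. This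
  product is a multiple of \<open>P\<close> and of \<open>Q\<close>, since each is an atom of
  \<open>V\<close>; idempotence removes both scalars, so \<open>P = P * Q = Q\<close>.\<close>

lemma canonical_projections_subset:
  assumes S: "is_canonical_projections n V S" and S': "is_canonical_projections n V S'"
  shows "S \<subseteq> S'"
proof
  interpret vs: vectorspace class_ring "module_mat TYPE(complex) n n" by (rule matrix_vs)
  have sub: "T \<subseteq> V" if "is_canonical_projections n V T" for T
  proof -
    have "T \<subseteq> carrier (module_mat TYPE(complex) n n)"
      using that by (auto simp: is_canonical_projections_def projection_def module_mat_simps)
    then show ?thesis
      using vs.in_own_span that by (auto simp: is_canonical_projections_def)
  qed
  fix P assume P: "P \<in> S"
  have Pc: "P \<in> carrier_mat n n" and P0: "P \<noteq> 0\<^sub>m n n" and PP: "P * P = P"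
    using S P by (auto simp: is_canonical_projections_def projection_def)
  have "\<exists>Q\<in>S'. P * Q \<noteq> 0\<^sub>m n n"
  proof (rule ccontr)
    assume "\<not> (\<exists>Q\<in>S'. P * Q \<noteq> 0\<^sub>m n n)"
    then have "P * 1\<^sub>m n = 0\<^sub>m n n"
      using mult_finsum_mat_zero[of S' n P] S' Pc
      by (auto simp: is_canonical_projections_def projection_def)
    with Pc P0 show False by simp
  qed
  then obtain Q where Q: "Q \<in> S'" "P * Q \<noteq> 0\<^sub>m n n" by blast
  have Qc: "Q \<in> carrier_mat n n" and QQ: "Q * Q = Q"
    using S' Q by (auto simp: is_canonical_projections_def projection_def)
  obtain c where c: "P * Q = c \<cdot>\<^sub>m P"
    using canonical_projection_mult[OF S _ P] sub[OF S'] Q by blast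
  obtain d where d: "P * Q = d \<cdot>\<^sub>m Q"
    using canonical_projection_mult[OF S' _ Q(1)] sub[OF S] P by blast
  have "(P * Q) * Q = P * Q" using Pc Qc QQ by (simp add: assoc_mult_mat[of P n n Q n Q n])
  then have "c \<cdot>\<^sub>m (c \<cdot>\<^sub>m P) = c \<cdot>\<^sub>m P"
    using mult_smult_assoc_mat[OF Pc Qc, of c] by (simp add: c)
  moreover have "c \<noteq> 0" using c Q(2) Pc by auto
  ultimately have cP: "c \<cdot>\<^sub>m P = P" by (rule smult_mat_idem[rotated])
  have "P * (P * Q) = P * Q" using assoc_mult_mat[OF Pc Pc Qc] PP by simp
  then have "d \<cdot>\<^sub>m (d \<cdot>\<^sub>m Q) = d \<cdot>\<^sub>m Q"
    using mult_smult_distrib[OF Pc Qc, of d] by (simp add: d)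
  moreover have "d \<noteq> 0" using d Q(2) Qc by auto
  ultimately have "d \<cdot>\<^sub>m Q = Q" by (rule smult_mat_idem[rotated])
  with c d cP have "P = Q" by metis
  with Q show "P \<in> S'" by simp
qed

lemma canonical_projections_eqI:
  assumes "is_canonical_projections n V S"
  shows "canonical_projections n V = S"
  unfolding canonical_projections_def
  using assms by (intro the_equality subset_antisym) (auto dest: canonical_projections_subset)

section \<open>Rank-one projections onto the vectors of a basis\<close>

definition rank_one_proj :: "nat \<Rightarrow> complex mat \<Rightarrow> nat \<Rightarrow> complex mat" where
  "rank_one_proj n U j = spectral_mat n U (\<lambda>i. if i = j then 1 else 0)"

text \<open>Canonical projections form a set, whereas probabilities are counted per basis vector;
  injectivity lets the set be indexed by \<open>{..<n}\<close> without losing equal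
  probabilities.\<close>

lemma inj_on_rank_one_proj:
  assumes U: "unitary_mat n U"
  shows "inj_on (rank_one_proj n U) {..<n}"
proof (rule inj_onI)
  fix i j assume "i \<in> {..<n}" "j \<in> {..<n}" "rank_one_proj n U i = rank_one_proj n U j"
  then have "i < n" "\<forall>k<n. (if k = i then 1 else 0) = (if k = j then 1 else (0::complex))"
    unfolding rank_one_proj_def spectral_mat_eq_iff[OF U] by simp_all
  from this(2)[rule_format, OF this(1)] show "i = j" by (simp split: if_splits)
qed

lemma finsum_rank_one_proj:
  assumes U: "unitary_mat n U"
  shows "finsum (module_mat TYPE(complex) n n) (\<lambda>P. P) (rank_one_proj n U ` {..<n}) = 1\<^sub>m n"
proof -
  interpret vs: vectorspace class_ring "module_mat TYPE(complex) n n" by (rule matrix_vs)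
  note Uc = unitary_mat_carrier[OF U]
  have "finsum (module_mat TYPE(complex) n n) (\<lambda>P. P) (rank_one_proj n U ` {..<k})
      = spectral_mat n U (\<lambda>i. if i < k then 1 else 0)" if "k \<le> n" for k
    using that
  proof (induction k)
    case 0
    then show ?case using spectral_mat_zero[OF Uc] by (simp add: module_mat_simps)
  next
    case (Suc k)
    have "rank_one_proj n U k \<notin> rank_one_proj n U ` {..<k}"
    proof
      assume "rank_one_proj n U k \<in> rank_one_proj n U ` {..<k}"
      then obtain i where "i < k" "rank_one_proj n U k = rank_one_proj n U i" by auto
      with inj_onD[OF inj_on_rank_one_proj[OF U], of k i] Suc.prems show False by simp
    qed
    moreover have "rank_one_proj n U i \<in> carrier_mat n n" for i
      unfolding rank_one_proj_def by (rule spectral_mat_carrier[OF Uc])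
    ultimately have "finsum (module_mat TYPE(complex) n n) (\<lambda>P. P) (rank_one_proj n U ` {..<Suc k})
        = rank_one_proj n U k + spectral_mat n U (\<lambda>i. if i < k then 1 else 0)"
      unfolding lessThan_Suc image_insert using Suc
      by (subst vs.finsum_insert) (auto simp: module_mat_simps)
    also have "\<dots> = spectral_mat n U (\<lambda>i. if i < Suc k then 1 else 0)"
      unfolding rank_one_proj_def spectral_mat_add[OF Uc] by (rule spectral_mat_cong[OF Uc]) auto
    finally show ?case .
  qed
  from this[OF order_refl] show ?thesis
    using spectral_mat_one[OF U] spectral_mat_cong[OF Uc, of "\<lambda>i. if i < n then 1 else 0" "\<lambda>i. 1"]
    by simp
qed

lemma span_rank_one_proj:
  assumes U: "unitary_mat n U"
  shows "LinearCombinations.module.span class_ring (module_mat TYPE(complex) n n)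
    (rank_one_proj n U ` {..<n}) = range (spectral_mat n U)" (is "?span = _")
proof
  interpret vs: vectorspace class_ring "module_mat TYPE(complex) n n" by (rule matrix_vs)
  note Uc = unitary_mat_carrier[OF U]
  have sub: "submodule class_ring (range (spectral_mat n U)) (module_mat TYPE(complex) n n)"
    by (unfold_locales, unfold matrix_vs_simps)
      (auto simp: spectral_mat_carrier[OF Uc] spectral_mat_add[OF Uc] spectral_mat_smult[OF Uc]
        spectral_mat_zero[OF Uc, symmetric])
  show "?span \<subseteq> range (spectral_mat n U)"
    by (rule vs.span_is_subset[OF _ sub]) (auto simp: rank_one_proj_def)
  have Sc: "rank_one_proj n U ` {..<n} \<subseteq> carrier (module_mat TYPE(complex) n n)"
    by (auto simp: rank_one_proj_def module_mat_simps spectral_mat_carrier[OF Uc])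
  interpret span: submodule class_ring ?span "module_mat TYPE(complex) n n"
    using Sc by (rule vs.span_is_submodule)
  \<comment> \<open>The values of \<open>f\<close> are switched on one index at a time, each adding
    a multiple of one projection.\<close>
  have "spectral_mat n U (\<lambda>i. if i < k then f i else 0) \<in> ?span" if "k \<le> n" for f k
    using that
  proof (induction k)
    case 0
    then show ?case
      using span.zero_closed by (simp add: spectral_mat_zero[OF Uc] module_mat_simps)
  next
    case (Suc k)
    have "rank_one_proj n U k \<in> ?span"
      using vs.in_own_span[OF Sc] Suc.prems by auto
    then have "f k \<cdot>\<^sub>m rank_one_proj n U k \<in> ?span"
      using span.smult_closed[of "f k"] by (simp add: module_mat_simps)
    then have "f k \<cdot>\<^sub>m rank_one_proj n U k + spectral_mat n U (\<lambda>i. if i < k then f i else 0) \<in> ?span"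
      using span.m_closed Suc by (simp add: module_mat_simps)
    moreover have "f k \<cdot>\<^sub>m rank_one_proj n U k + spectral_mat n U (\<lambda>i. if i < k then f i else 0)
        = spectral_mat n U (\<lambda>i. if i < Suc k then f i else 0)"
      unfolding rank_one_proj_def spectral_mat_smult[OF Uc] spectral_mat_add[OF Uc]
      by (rule spectral_mat_cong[OF Uc]) (auto simp: less_Suc_eq)
    ultimately show ?case by simp
  qed
  from this[OF order_refl] have "spectral_mat n U f \<in> ?span" for f
    using spectral_mat_cong[OF Uc, of "\<lambda>i. if i < n then f i else 0" f] by metis
  then show "range (spectral_mat n U) \<subseteq> ?span" by blast
qed

lemma canonical_projections_spectral:
  assumes U: "unitary_mat n U"
  shows "canonical_projections n (range (spectral_mat n U)) = rank_one_proj n U ` {..<n}"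
proof (rule canonical_projections_eqI)
  note Uc = unitary_mat_carrier[OF U]
  have "projection n (rank_one_proj n U j)" for j
    unfolding projection_def rank_one_proj_def spectral_mat_adjoint[OF Uc] spectral_mat_mult[OF U]
    by (auto simp: spectral_mat_carrier[OF Uc] intro!: spectral_mat_cong[OF Uc])
  moreover have "rank_one_proj n U j \<noteq> 0\<^sub>m n n" if "j < n" for j
    unfolding rank_one_proj_def spectral_mat_zero[OF Uc, symmetric] spectral_mat_eq_iff[OF U]
    using that by auto
  moreover have "rank_one_proj n U i * rank_one_proj n U j = 0\<^sub>m n n" if "i \<noteq> j" for i j
    unfolding rank_one_proj_def spectral_mat_zero[OF Uc, symmetric] spectral_mat_mult[OF U]
    using that by (intro spectral_mat_cong[OF Uc]) auto
  ultimately show "is_canonical_projections n (range (spectral_mat n U)) (rank_one_proj n U ` {..<n})"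
    unfolding is_canonical_projections_def span_rank_one_proj[OF U] finsum_rank_one_proj[OF U]
    by (auto, metis)
qed

section \<open>Entropies of spectral decompositions\<close>

text \<open>The projection is \<open>u u^*\<close> for the column \<open>u\<close> of
  \<open>U\<close> at \<open>j\<close>, so the trace of its product with \<open>\<rho>\<close> is
  \<open>u^* \<rho> u\<close>, a diagonal entry of the conjugated matrix.\<close>

lemma contextual_renyi_entropy_spectral:
  assumes U: "unitary_mat n U" and \<rho>: "\<rho> \<in> carrier_mat n n"
  shows "contextual_renyi_entropy q n \<rho> (range (spectral_mat n U)) =
    renyi_entropy q (image_mset (\<lambda>j. Re ((mat_adjoint U * \<rho> * U) $$ (j, j))) (mset_set {..<n}))"
proof -
  note Uc = unitary_mat_carrier[OF U]
  have "mat_trace (\<rho> * rank_one_proj n U j) = (mat_adjoint U * \<rho> * U) $$ (j, j)" if j: "j < n" for j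
  proof -
    have P: "rank_one_proj n U j \<in> carrier_mat n n"
      unfolding rank_one_proj_def by (rule spectral_mat_carrier[OF Uc])
    have Pe: "rank_one_proj n U j $$ (l, i) = U $$ (l, j) * cnj (U $$ (i, j))"
      if "l < n" "i < n" for l i
    proof -
      have "rank_one_proj n U j $$ (l, i)
          = (\<Sum>k<n. if k = j then U $$ (l, j) * cnj (U $$ (i, j)) else 0)"
        unfolding rank_one_proj_def index_spectral_mat[OF Uc that]
        by (intro sum.cong) auto
      then show ?thesis using j by simp
    qed
    have "mat_trace (\<rho> * rank_one_proj n U j)
        = (\<Sum>i<n. \<Sum>l<n. \<rho> $$ (i, l) * (U $$ (l, j) * cnj (U $$ (i, j))))"
      using \<rho> P by (simp add: mat_trace_def scalar_prod_def Pe atLeast0LessThan)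
    also have "\<dots> = (\<Sum>i<n. cnj (U $$ (i, j)) * (\<Sum>l<n. \<rho> $$ (i, l) * U $$ (l, j)))"
      by (simp add: sum_distrib_left mult_ac)
    also have "\<dots> = (mat_adjoint U * (\<rho> * U)) $$ (j, j)"
      using j \<rho> Uc by (simp add: scalar_prod_def index_mat_adjoint atLeast0LessThan)
    also have "mat_adjoint U * (\<rho> * U) = mat_adjoint U * \<rho> * U"
      using mat_adjoint_carrier[OF Uc] \<rho> Uc by (rule assoc_mult_mat[symmetric])
    finally show ?thesis .
  qed
  then show ?thesis
    unfolding contextual_renyi_entropy_def canonical_projections_spectral[OF U]
      image_mset_mset_set[OF inj_on_rank_one_proj[OF U], symmetric] multiset.map_comp o_def
    by (intro arg_cong[of _ _ "renyi_entropy q"] image_mset_cong) simp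
qed

lemma density_matrix_spectral:
  assumes "density_matrix n \<rho>"
  obtains W d where "unitary_mat n W" "\<rho> = spectral_mat n W (\<lambda>i. complex_of_real (d i))"
    "\<forall>i<n. 0 \<le> d i" "(\<Sum>i<n. d i) = 1"
proof -
  have \<rho>: "\<rho> \<in> carrier_mat n n" and adj: "mat_adjoint \<rho> = \<rho>" and trace: "mat_trace \<rho> = 1"
    and psd: "\<And>v. v \<in> carrier_vec n \<Longrightarrow> 0 \<le> (\<rho> *\<^sub>v v) \<bullet>c v"
    using assms by (auto simp: density_matrix_def positive_semidefinite_def)
  \<comment> \<open>Self-adjointness closes the one-element family under adjoints, so the spectral
    theorem is a special case of simultaneous diagonalization.\<close>
  obtain W where W: "unitary_mat n W" and "{\<rho>} \<subseteq> range (spectral_mat n W)"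
    by (rule simultaneous_unitary_diagonalization[of "{\<rho>}" n]) (use \<rho> adj in auto)
  then obtain f where f: "\<rho> = spectral_mat n W f" by blast
  note Wc = unitary_mat_carrier[OF W]
  note Wac = mat_adjoint_carrier[OF Wc]
  have f_real: "f i = complex_of_real (Re (f i))" if "i < n" for i
  proof -
    have "spectral_mat n W (\<lambda>i. cnj (f i)) = spectral_mat n W f"
      using adj unfolding f spectral_mat_adjoint[OF Wc] .
    then show ?thesis
      using that unfolding spectral_mat_eq_iff[OF W] by (auto simp: complex_eq_iff)
  qed
  have \<rho>_eq: "\<rho> = spectral_mat n W (\<lambda>i. complex_of_real (Re (f i)))"
    unfolding f by (rule spectral_mat_cong[OF Wc f_real])
  moreover have "\<forall>i<n. 0 \<le> Re (f i)"
  proof (intro allI impI)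
    fix i assume i: "i < n"
    \<comment> \<open>\<open>v\<close> is column \<open>i\<close> of \<open>W\<close>, a unit
      eigenvector, so the positivity condition at \<open>v\<close> returns its eigenvalue
      \<open>f i\<close>.\<close>
    define v where "v = W *\<^sub>v unit_vec n i"
    have v: "v \<in> carrier_vec n" unfolding v_def by (rule mult_mat_vec_carrier[OF Wc]) simp
    have "(\<rho> *\<^sub>v v) \<bullet>c v = (mat_adjoint W *\<^sub>v (\<rho> *\<^sub>v v)) \<bullet>c unit_vec n i"
      using inner_mult_mat_vec[OF Wac mult_mat_vec_carrier[OF \<rho> v], of "unit_vec n i"]
      by (simp add: v_def)
    also have "mat_adjoint W *\<^sub>v (\<rho> *\<^sub>v v) = (mat_adjoint W * \<rho> * W) *\<^sub>v unit_vec n i"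
      unfolding v_def using Wac \<rho> Wc
      by (simp add: assoc_mult_mat_vec[of _ n n _ n] mult_carrier_mat[of _ n n _ n])
    also have "mat_adjoint W * \<rho> * W = mat_diag n f"
      unfolding f by (rule adjoint_spectral_mat_mult[OF W])
    also have "(mat_diag n f *\<^sub>v unit_vec n i) \<bullet>c unit_vec n i = f i"
    proof -
      have "conjugate (unit_vec n i) = (unit_vec n i :: complex Matrix.vec)"
        by (rule eq_vecI) (auto simp: unit_vec_def)
      then show ?thesis
        using i by (simp add: scalar_prod_right_unit[of i n] mat_diag_def)
    qed
    finally show "0 \<le> Re (f i)" using psd[OF v] by (simp add: less_eq_complex_def)
  qed
  moreover have "(\<Sum>i<n. Re (f i)) = 1"
  proof -
    have "mat_trace \<rho> = (\<Sum>i<n. \<Sum>k<n. f k * (W $$ (i, k) * cnj (W $$ (i, k))))"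
      using \<rho> by (simp add: mat_trace_def f index_spectral_mat[OF Wc] mult_ac
        carrier_matD[OF spectral_mat_carrier[OF Wc]])
    also have "\<dots> = (\<Sum>k<n. f k * (\<Sum>i<n. W $$ (i, k) * cnj (W $$ (i, k))))"
      unfolding sum_distrib_left by (rule sum.swap)
    also have "\<dots> = (\<Sum>k<n. f k)" by (simp add: sum_unitary_cols[OF W])
    finally have "(\<Sum>k<n. f k) = 1" using trace by simp
    from arg_cong[OF this, of Re] show ?thesis by simp
  qed
  ultimately show ?thesis using W by (intro that)
qed

text \<open>Unitary conjugation is a similarity, so the characteristic polynomial is that of the
  diagonal matrix and its roots are the \<open>d i\<close> with multiplicity.\<close>

lemma quantum_renyi_entropy_spectral:
  assumes W: "unitary_mat n W"
  shows "quantum_renyi_entropy q (spectral_mat n W (\<lambda>i. complex_of_real (d i)))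
    = renyi_entropy q (image_mset d (mset_set {..<n}))"
proof (rule quantum_renyi_entropy_eigenvalues)
  note Wc = unitary_mat_carrier[OF W]
  let ?A = "spectral_mat n W (\<lambda>i. complex_of_real (d i))"
  let ?D = "mat_diag n (\<lambda>i. complex_of_real (d i))"
  have "similar_mat_wit ?A ?D W (mat_adjoint W)"
    using W spectral_mat_carrier[OF Wc] Wc
    by (auto simp: similar_mat_wit_def Let_def unitary_mat_def spectral_mat_def[symmetric]
      carrier_matD[OF spectral_mat_carrier[OF Wc]])
  then have "char_poly ?A = char_poly ?D"
    by (intro char_poly_similar) (auto simp: similar_mat_def)
  also have "\<dots> = (\<Prod>a\<leftarrow>diag_mat ?D. [:- a, 1:])"
    by (rule char_poly_upper_triangular[OF mat_diag_dim]) (auto simp: mat_diag_def)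
  also have "diag_mat ?D = map (\<lambda>i. complex_of_real (d i)) [0..<n]"
    by (auto simp: diag_mat_def mat_diag_def)
  also have "(\<Prod>a\<leftarrow>map (\<lambda>i. complex_of_real (d i)) [0..<n]. [:- a, 1:])
      = (\<Prod>i<n. [:- complex_of_real (d i), 1:])"
    by (simp add: prod.list_conv_set_nth o_def atLeast0LessThan
      del: map_map)
  finally show "char_poly ?A = (\<Prod>i<n. [:- complex_of_real (d i), 1:])" .
qed

lemma quantum_renyi_entropy_le_contextual:
  assumes q: "0 \<le> q" and \<rho>: "density_matrix n \<rho>" and U: "unitary_mat n U"
  shows "quantum_renyi_entropy q \<rho> \<le> contextual_renyi_entropy q n \<rho> (range (spectral_mat n U))"
proof -
  obtain W d where W: "unitary_mat n W" and \<rho>_eq: "\<rho> = spectral_mat n W (\<lambda>i. complex_of_real (d i))"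
    and d: "\<forall>i<n. 0 \<le> d i" "(\<Sum>i<n. d i) = 1"
    using \<rho> by (rule density_matrix_spectral)
  have \<rho>c: "\<rho> \<in> carrier_mat n n"
    using \<rho> by (simp add: density_matrix_def positive_semidefinite_def)
  note Wc = unitary_mat_carrier[OF W] and Uc = unitary_mat_carrier[OF U]
  note Wac = mat_adjoint_carrier[OF Wc] and Uac = mat_adjoint_carrier[OF Uc]
  define Z where "Z = mat_adjoint U * W"
  have Z: "unitary_mat n Z"
    unfolding Z_def by (rule unitary_mat_mult[OF unitary_mat_adjoint[OF U] W])
  note Zc = unitary_mat_carrier[OF Z]
  define w where "w j i = (cmod (Z $$ (j, i)))\<^sup>2" for j i
  \<comment> \<open>In this complex form the unitarity relations of \<open>Z\<close> become the row
    and column sums of \<open>w\<close>.\<close>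
  have w: "complex_of_real (w j i) = Z $$ (j, i) * cnj (Z $$ (j, i))" for j i
    unfolding w_def by (rule complex_norm_square)
  have rows: "(\<Sum>i<n. w j i) = 1" if "j < n" for j
  proof -
    have "complex_of_real (\<Sum>i<n. w j i) = 1"
      using sum_unitary_rows[OF Z that that] by (simp add: w)
    then show ?thesis by (simp only: of_real_eq_1_iff)
  qed
  have cols: "(\<Sum>j<n. w j i) = 1" if "i < n" for i
  proof -
    have "complex_of_real (\<Sum>j<n. w j i) = 1"
      using sum_unitary_cols[OF Z that that] by (simp add: w)
    then show ?thesis by (simp only: of_real_eq_1_iff)
  qed
  note assoc = assoc_mult_mat[of _ n n _ n _ n] mult_carrier_mat[of _ n n _ n] mat_diag_dim
  \<comment> \<open>Conjugation by \<open>U\<close> turns the eigenbasis \<open>W\<close> into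
    \<open>Z\<close> and keeps the eigenvalues, so the diagonal entries are averages of
    \<open>d\<close> with weights \<open>w\<close>.\<close>
  have "mat_adjoint U * \<rho> * U = spectral_mat n Z (\<lambda>i. complex_of_real (d i))"
    unfolding \<rho>_eq spectral_mat_def Z_def mat_adjoint_mult[OF Uac Wc] mat_adjoint_adjoint
    using Uc Uac Wc Wac by (simp only: assoc)
  then have diag: "Re ((mat_adjoint U * \<rho> * U) $$ (j, j)) = (\<Sum>i<n. w j i * d i)" if "j < n" for j
  proof -
    have "spectral_mat n Z (\<lambda>i. complex_of_real (d i)) $$ (j, j)
        = complex_of_real (\<Sum>i<n. w j i * d i)"
      unfolding index_spectral_mat[OF Zc that that] by (simp add: w mult_ac)
    then show ?thesis using \<open>mat_adjoint U * \<rho> * U = _\<close> by simp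
  qed
  have "quantum_renyi_entropy q \<rho> = renyi_entropy q (image_mset d (mset_set {..<n}))"
    unfolding \<rho>_eq by (rule quantum_renyi_entropy_spectral[OF W])
  also have "\<dots> \<le> renyi_entropy q (image_mset (\<lambda>j. \<Sum>i<n. w j i * d i) (mset_set {..<n}))"
    using q d rows cols by (intro renyi_entropy_doubly_stochastic_mono) (auto simp: w_def)
  also have "\<dots> = contextual_renyi_entropy q n \<rho> (range (spectral_mat n U))"
    unfolding contextual_renyi_entropy_spectral[OF U \<rho>c]
    by (intro arg_cong[of _ _ "renyi_entropy q"] image_mset_cong) (simp add: diag)
  finally show ?thesis .
qed

theorem mainTheorem5:
  fixes n :: nat and q :: real and \<rho> :: "complex mat"
  assumes "n \<ge> 2"
    and "q \<ge> 0"
    and "density_matrix n \<rho>"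
  shows "quantum_renyi_entropy q \<rho> \<in> {contextual_renyi_entropy q n \<rho> V | V. maximal_context n V}
    \<and> (\<forall>x \<in> {contextual_renyi_entropy q n \<rho> V | V. maximal_context n V}.
          quantum_renyi_entropy q \<rho> \<le> x)"
proof
  obtain W d where W: "unitary_mat n W" and \<rho>_eq: "\<rho> = spectral_mat n W (\<lambda>i. complex_of_real (d i))"
    using assms(3) by (rule density_matrix_spectral)
  have \<rho>: "\<rho> \<in> carrier_mat n n"
    using assms(3) by (simp add: density_matrix_def positive_semidefinite_def)
  have diag: "Re ((mat_adjoint W * \<rho> * W) $$ (j, j)) = d j" if "j < n" for j
    using that unfolding \<rho>_eq adjoint_spectral_mat_mult[OF W] by (simp add: mat_diag_def)
  have "contextual_renyi_entropy q n \<rho> (range (spectral_mat n W))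
      = renyi_entropy q (image_mset d (mset_set {..<n}))"
    unfolding contextual_renyi_entropy_spectral[OF W \<rho>]
    by (intro arg_cong[of _ _ "renyi_entropy q"] image_mset_cong) (simp add: diag)
  also have "\<dots> = quantum_renyi_entropy q \<rho>"
    unfolding \<rho>_eq by (rule quantum_renyi_entropy_spectral[OF W, symmetric])
  finally show "quantum_renyi_entropy q \<rho>
      \<in> {contextual_renyi_entropy q n \<rho> V | V. maximal_context n V}"
    using maximal_context_spectral[OF W assms(1)] by (intro CollectI exI[of _ "range (spectral_mat n W)"]) simp
  show "\<forall>x \<in> {contextual_renyi_entropy q n \<rho> V | V. maximal_context n V}.
          quantum_renyi_entropy q \<rho> \<le> x"
  proof
    fix x assume "x \<in> {contextual_renyi_entropy q n \<rho> V | V. maximal_context n V}"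
    then obtain V where V: "maximal_context n V" and x: "x = contextual_renyi_entropy q n \<rho> V" by blast
    from V assms(1) obtain U where "unitary_mat n U" "V = range (spectral_mat n U)"
      by (rule maximal_contextE)
    then show "quantum_renyi_entropy q \<rho> \<le> x"
      using quantum_renyi_entropy_le_contextual[OF assms(2,3)] x by simp
  qed
qed

end
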